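(* Let $(X,d)$ be a Polish space. Then its $L^2$-Wasserstein space $(\mathcal{P}_2(X),W_2)$ has a cone structure if and only if the underlying space $(X,d)$ has a cone structure. Furthermore, if this is the case, $\mathcal{P}_2(X)$ is non-branching at its vertex if and only if $X$ is non-branching at its vertex.
   Context: A Polish space is a complete separable metric space. $\mathcal{P}_2(X)$ is the set of Borel probability measures $\mu$ on $X$ with finite second moment, i.e. $\int_X d(x_0,x)^2\,d\mu(x)<\infty$ for some (equivalently every) $x_0\in X$, endowed with the distance $$W_2(\mu,\nu)=\Bigl(\inf_{\pi\in\Pi(\mu,\nu)}\int_{X\times X}d(x,y)^2\,d\pi(x,y)\Bigr)^{1/2},$$ where $\Pi(\mu,\nu)$ is the set of Borel probability measures on $X\times X$ with marginals $\mu$ and $\nu$. The cone over a metric space $(\Sigma,\angle)$ is the quotient $C(\Sigma)=\Sigma\times[0,\infty)/\sim$, which identifies all points $(\xi,0)$, $\xi\in\Sigma$, to one point called the vertex (and makes no other identification), with the distance $$d_C((\xi,s),(\eta,t))=\sqrt{s^2+t^2-2st\cos(\min\{\angle(\xi,\eta),\pi\})}.$$ A metric space has a cone structure if it is isometric to $C(\Sigma)$ for some metric space $\Sigma$; its vertex is the point corresponding to the vertex of $C(\Sigma)$ under the isometry. A metric space $(X,d)$ is non-branching at a point $x\in X$ if for all $u,v,w\in X$, the equalities $d(u,v)=d(u,x)+d(x,v)=d(u,x)+d(x,w)=d(u,w)$ imply $v=w$.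
   Formalization: In the definition of non-branching at x, the point u is required to differ from x; with u = x allowed, the claim fails for X = [0,∞), which is non-branching at 0 while P_2(X) is not at its vertex (take u = δ_0 and two distinct measures of equal second moment). *)

theory Defs
  imports "HOL-Probability.Probability"
begin

section \<open>Euclidean cones over metric spaces\<close>

definition cone_rel :: "'s set \<Rightarrow> (('s \<times> real) \<times> ('s \<times> real)) set" where
  "cone_rel \<Sigma> =
     {((\<xi>, s), (\<eta>, t)). \<xi> \<in> \<Sigma> \<and> \<eta> \<in> \<Sigma> \<and> 0 \<le> s \<and> 0 \<le> t \<and>
        ((s = 0 \<and> t = 0) \<or> (\<xi> = \<eta> \<and> s = t))}"

definition metric_cone :: "'s set \<Rightarrow> ('s \<times> real) set set" where
  "metric_cone \<Sigma> = (\<Sigma> \<times> {0..}) // cone_rel \<Sigma>"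

text \<open>The common equivalence class of all pairs \<open>(\<xi>, 0)\<close>; it is a point of the cone only if
  \<open>\<Sigma>\<close> is nonempty (the cone over the empty set is the empty quotient).\<close>

definition cone_vertex :: "'s set \<Rightarrow> ('s \<times> real) set" where
  "cone_vertex \<Sigma> = \<Sigma> \<times> {0}"

definition cone_pre_dist :: "('s \<Rightarrow> 's \<Rightarrow> real) \<Rightarrow> 's \<times> real \<Rightarrow> 's \<times> real \<Rightarrow> real" where
  "cone_pre_dist ang = (\<lambda>(\<xi>, s) (\<eta>, t).
     sqrt (s\<^sup>2 + t\<^sup>2 - 2 * s * t * cos (min (ang \<xi> \<eta>) pi)))"

text \<open>The distance of two classes is the single value of \<^const>\<open>cone_pre_dist\<close> on their
  representatives; see \<open>cone_dist_class\<close> below for independence of the representatives.\<close>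

definition cone_dist :: "('s \<Rightarrow> 's \<Rightarrow> real) \<Rightarrow> ('s \<times> real) set \<Rightarrow> ('s \<times> real) set \<Rightarrow> real" where
  "cone_dist ang A B = the_elem ((\<lambda>(p, q). cone_pre_dist ang p q) ` (A \<times> B))"

definition isometry_between ::
    "('a \<Rightarrow> 'b) \<Rightarrow> 'a set \<Rightarrow> ('a \<Rightarrow> 'a \<Rightarrow> real) \<Rightarrow> 'b set \<Rightarrow> ('b \<Rightarrow> 'b \<Rightarrow> real) \<Rightarrow> bool" where
  "isometry_between f M d N e \<longleftrightarrow>
     bij_betw f M N \<and> (\<forall>x\<in>M. \<forall>y\<in>M. e (f x) (f y) = d x y)"

text \<open>The base \<open>\<Sigma>\<close> is taken inside the type carrying \<open>M\<close>. This is no restriction: a base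
  living in any other type embeds into \<open>M\<close> as the unit sphere around the vertex, see
  \<open>has_cone_structureI\<close> and \<open>is_cone_vertexI\<close> below.\<close>

definition has_cone_structure :: "'a set \<Rightarrow> ('a \<Rightarrow> 'a \<Rightarrow> real) \<Rightarrow> bool" where
  "has_cone_structure M d \<longleftrightarrow>
     (\<exists>(\<Sigma> :: 'a set) ang f. Metric_space \<Sigma> ang \<and> isometry_between f M d (metric_cone \<Sigma>) (cone_dist ang))"

text \<open>A space may have several vertices (every point of the real line is one), so being a vertex
  is a relation: it holds of the vertex of each cone structure of \<open>M\<close>.\<close>

definition is_cone_vertex :: "'a set \<Rightarrow> ('a \<Rightarrow> 'a \<Rightarrow> real) \<Rightarrow> 'a \<Rightarrow> bool" where
  "is_cone_vertex M d v \<longleftrightarrow>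
     (\<exists>(\<Sigma> :: 'a set) ang f. Metric_space \<Sigma> ang \<and> isometry_between f M d (metric_cone \<Sigma>) (cone_dist ang) \<and>
        v \<in> M \<and> f v = cone_vertex \<Sigma>)"

text \<open>The condition \<open>u \<noteq> x\<close> excludes the degenerate case in which the equalities only say that
  \<open>v\<close> and \<open>w\<close> are equidistant from \<open>x\<close>. (The cases \<open>v = x\<close> and \<open>w = x\<close> are harmless, since
  then \<open>v = w\<close> follows.)\<close>

definition non_branching_at :: "'a set \<Rightarrow> ('a \<Rightarrow> 'a \<Rightarrow> real) \<Rightarrow> 'a \<Rightarrow> bool" where
  "non_branching_at M d x \<longleftrightarrow>
     (\<forall>u\<in>M. \<forall>v\<in>M. \<forall>w\<in>M. u \<noteq> x \<longrightarrow>
        d u v = d u x + d x v \<and> d u x + d x v = d u x + d x w \<and> d u x + d x w = d u w \<longrightarrow> v = w)"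

section \<open>The quadratic Wasserstein space\<close>

definition P2 :: "'a::metric_space measure set" where
  "P2 = {\<mu>. sets \<mu> = sets borel \<and> prob_space \<mu> \<and>
           (\<exists>x0. (\<integral>\<^sup>+ x. ennreal ((dist x0 x)\<^sup>2) \<partial>\<mu>) < \<infinity>)}"

definition couplings :: "'a::metric_space measure \<Rightarrow> 'a measure \<Rightarrow> ('a \<times> 'a) measure set" where
  "couplings \<mu> \<nu> = {\<pi>. sets \<pi> = sets borel \<and> prob_space \<pi> \<and>
                       distr \<pi> borel fst = \<mu> \<and> distr \<pi> borel snd = \<nu>}"

definition W2 :: "'a::metric_space measure \<Rightarrow> 'a measure \<Rightarrow> real" where
  "W2 \<mu> \<nu> =
     sqrt (enn2real (INF \<pi>\<in>couplings \<mu> \<nu>. \<integral>\<^sup>+ (x, y). ennreal ((dist x y)\<^sup>2) \<partial>\<pi>))"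

section \<open>Well-definedness and independence of the type of the base\<close>

lemma equiv_cone_rel: "equiv (\<Sigma> \<times> {0..}) (cone_rel \<Sigma>)"
  by (rule equivI) (auto simp: cone_rel_def refl_on_def sym_def trans_def)

lemma cone_vertex_class:
  assumes "\<xi> \<in> \<Sigma>"
  shows "cone_rel \<Sigma> `` {(\<xi>, 0)} = cone_vertex \<Sigma>"
  using assms by (auto simp: cone_rel_def cone_vertex_def)

lemma cone_dist_class:
  assumes "p \<in> \<Sigma> \<times> {0..}" "q \<in> \<Sigma> \<times> {0..}"
  shows "cone_dist ang (cone_rel \<Sigma> `` {p}) (cone_rel \<Sigma> `` {q}) = cone_pre_dist ang p q"
proof -
  let ?P = "cone_rel \<Sigma> `` {p}" and ?Q = "cone_rel \<Sigma> `` {q}"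
  have "cone_pre_dist ang p' q' = cone_pre_dist ang p q" if "p' \<in> ?P" "q' \<in> ?Q" for p' q'
    using that by (auto simp: cone_rel_def cone_pre_dist_def)
  then have "(\<lambda>(p, q). cone_pre_dist ang p q) ` (?P \<times> ?Q) =
      (\<lambda>_. cone_pre_dist ang p q) ` (?P \<times> ?Q)"
    by (intro image_cong refl) (simp only: mem_Times_iff case_prod_beta)
  moreover have "p \<in> ?P" "q \<in> ?Q"
    using assms by (auto simp: cone_rel_def)
  then have "?P \<times> ?Q \<noteq> {}" by blast
  ultimately show ?thesis by (simp add: cone_dist_def image_constant_conv)
qed

lemma cone_base_transfer:
  fixes \<Sigma> :: "'s set" and j :: "'s \<Rightarrow> 'a"
  assumes S: "Metric_space \<Sigma> ang" and j: "inj_on j \<Sigma>"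
  defines "ang' \<equiv> (\<lambda>x y. ang (inv_into \<Sigma> j x) (inv_into \<Sigma> j y))"
  shows "Metric_space (j ` \<Sigma>) ang'"
    and "isometry_between ((`) (map_prod j id)) (metric_cone \<Sigma>) (cone_dist ang)
           (metric_cone (j ` \<Sigma>)) (cone_dist ang')"
    and "map_prod j id ` cone_vertex \<Sigma> = cone_vertex (j ` \<Sigma>)"
proof -
  interpret Metric_space \<Sigma> ang by fact
  let ?h = "map_prod j id :: 's \<times> real \<Rightarrow> 'a \<times> real"
  show "Metric_space (j ` \<Sigma>) ang'"
  proof
    show "ang' x y = ang' y x" for x y by (simp add: ang'_def commute)
  qed (use j in \<open>auto simp: ang'_def inj_on_eq_iff triangle\<close>)
  show "?h ` cone_vertex \<Sigma> = cone_vertex (j ` \<Sigma>)"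
    by (auto simp: cone_vertex_def image_iff)
  have cls: "?h ` (cone_rel \<Sigma> `` {p}) = cone_rel (j ` \<Sigma>) `` {?h p}"
    if "p \<in> \<Sigma> \<times> {0..}" for p
  proof
    show "?h ` (cone_rel \<Sigma> `` {p}) \<subseteq> cone_rel (j ` \<Sigma>) `` {?h p}"
      using that by (auto simp: cone_rel_def)
    show "cone_rel (j ` \<Sigma>) `` {?h p} \<subseteq> ?h ` (cone_rel \<Sigma> `` {p})"
    proof
      fix z assume z: "z \<in> cone_rel (j ` \<Sigma>) `` {?h p}"
      obtain \<xi> s where p: "p = (\<xi>, s)" by (cases p)
      obtain y t where zt: "z = (y, t)" by (cases z)
      from z p zt obtain \<eta> where "\<eta> \<in> \<Sigma>" "y = j \<eta>" by (auto simp: cone_rel_def)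
      then have "(\<eta>, t) \<in> cone_rel \<Sigma> `` {p}"
        using z that j by (auto simp: cone_rel_def p zt inj_on_eq_iff)
      moreover have "z = ?h (\<eta>, t)" using zt \<open>y = j \<eta>\<close> by simp
      ultimately show "z \<in> ?h ` (cone_rel \<Sigma> `` {p})" by blast
    qed
  qed
  have "cone_dist ang' (?h ` A) (?h ` B) = cone_dist ang A B"
    if "A \<in> metric_cone \<Sigma>" "B \<in> metric_cone \<Sigma>" for A B
  proof -
    from that obtain p q where p: "p \<in> \<Sigma> \<times> {0..}" "A = cone_rel \<Sigma> `` {p}"
      and q: "q \<in> \<Sigma> \<times> {0..}" "B = cone_rel \<Sigma> `` {q}"
      by (auto simp: metric_cone_def elim!: quotientE)
    have "?h p \<in> j ` \<Sigma> \<times> {0..}" "?h q \<in> j ` \<Sigma> \<times> {0..}" using p q by auto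
    then have "cone_dist ang' (?h ` A) (?h ` B) = cone_pre_dist ang' (?h p) (?h q)"
      using p q by (simp only: cls cone_dist_class)
    also have "\<dots> = cone_pre_dist ang p q"
      using p q by (auto simp: cone_pre_dist_def ang'_def j)
    also have "\<dots> = cone_dist ang A B" using p q by (simp only: cone_dist_class)
    finally show ?thesis .
  qed
  moreover have "bij_betw ((`) ?h) (metric_cone \<Sigma>) (metric_cone (j ` \<Sigma>))"
    unfolding bij_betw_def
  proof
    have sub: "A \<subseteq> \<Sigma> \<times> UNIV" if "A \<in> metric_cone \<Sigma>" for A
      using that by (auto simp: metric_cone_def cone_rel_def elim!: quotientE)
    have "inj_on ?h (\<Sigma> \<times> UNIV)" using j by (auto simp: inj_on_def)
    then show "inj_on ((`) ?h) (metric_cone \<Sigma>)"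
      using sub by (meson inj_onI inj_on_image_eq_iff)
    show "(`) ?h ` metric_cone \<Sigma> = metric_cone (j ` \<Sigma>)"
    proof
      show "(`) ?h ` metric_cone \<Sigma> \<subseteq> metric_cone (j ` \<Sigma>)"
      proof
        fix B assume "B \<in> (`) ?h ` metric_cone \<Sigma>"
        then obtain p where p: "p \<in> \<Sigma> \<times> {0..}" "B = ?h ` (cone_rel \<Sigma> `` {p})"
          by (auto simp: metric_cone_def elim!: quotientE)
        moreover from p have "?h p \<in> j ` \<Sigma> \<times> {0..}" by auto
        ultimately show "B \<in> metric_cone (j ` \<Sigma>)" by (simp only: cls metric_cone_def quotientI)
      qed
      show "metric_cone (j ` \<Sigma>) \<subseteq> (`) ?h ` metric_cone \<Sigma>"
      proof
        fix B assume "B \<in> metric_cone (j ` \<Sigma>)"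
        then obtain z where z: "z \<in> j ` \<Sigma> \<times> {0..}" "B = cone_rel (j ` \<Sigma>) `` {z}"
          by (auto simp: metric_cone_def elim!: quotientE)
        then obtain p where p: "p \<in> \<Sigma> \<times> {0..}" "z = ?h p" by force
        then have "B = ?h ` (cone_rel \<Sigma> `` {p})" using z by (simp only: cls)
        then show "B \<in> (`) ?h ` metric_cone \<Sigma>" using p by (auto simp: metric_cone_def intro: quotientI)
      qed
    qed
  qed
  ultimately show "isometry_between ((`) ?h) (metric_cone \<Sigma>) (cone_dist ang) (metric_cone (j ` \<Sigma>)) (cone_dist ang')"
    by (simp add: isometry_between_def)
qed

lemma isometry_between_comp:
  assumes "isometry_between f M d N e" "isometry_between g N e K k"
  shows "isometry_between (g \<circ> f) M d K k"
  using assms unfolding isometry_between_def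
  by (metis bij_betw_apply bij_betw_trans comp_apply)

lemma cone_base_embeds:
  assumes "isometry_between f M d (metric_cone \<Sigma>) e"
  shows "inj_on (\<lambda>\<xi>. inv_into M f (cone_rel \<Sigma> `` {(\<xi>, 1)})) \<Sigma>"
proof (rule inj_onI)
  fix \<xi> \<eta> assume *: "\<xi> \<in> \<Sigma>" "\<eta> \<in> \<Sigma>"
    "inv_into M f (cone_rel \<Sigma> `` {(\<xi>, 1)}) = inv_into M f (cone_rel \<Sigma> `` {(\<eta>, 1)})"
  have "cone_rel \<Sigma> `` {(\<xi>, 1)} \<in> f ` M" "cone_rel \<Sigma> `` {(\<eta>, 1)} \<in> f ` M"
    using assms * by (auto simp: isometry_between_def bij_betw_def metric_cone_def intro!: quotientI)
  with * have "cone_rel \<Sigma> `` {(\<xi>, 1)} = cone_rel \<Sigma> `` {(\<eta>, 1)}"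
    by (metis f_inv_into_f)
  moreover have "(\<xi>, 1) \<in> cone_rel \<Sigma> `` {(\<xi>, 1)}" using * by (auto simp: cone_rel_def)
  ultimately show "\<xi> = \<eta>" by (auto simp: cone_rel_def)
qed

lemma has_cone_structureI:
  fixes \<Sigma> :: "'s set" and M :: "'a set"
  assumes "Metric_space \<Sigma> ang" "isometry_between f M d (metric_cone \<Sigma>) (cone_dist ang)"
  shows "has_cone_structure M d"
  unfolding has_cone_structure_def
  using cone_base_transfer[OF assms(1) cone_base_embeds[OF assms(2)]]
    isometry_between_comp[OF assms(2)] by blast

lemma is_cone_vertexI:
  fixes \<Sigma> :: "'s set" and M :: "'a set"
  assumes "Metric_space \<Sigma> ang" "isometry_between f M d (metric_cone \<Sigma>) (cone_dist ang)"
    and "v \<in> M" "f v = cone_vertex \<Sigma>"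
  shows "is_cone_vertex M d v"
proof -
  note t = cone_base_transfer[OF assms(1) cone_base_embeds[OF assms(2)]]
  show ?thesis
    unfolding is_cone_vertex_def
    by (intro exI conjI) (rule t(1), rule isometry_between_comp[OF assms(2) t(2)],
      rule assms(3), use assms(4) t(3) in simp)
qed

end

theory Submission
  imports Defs
begin

text \<open>A metric space is a cone with vertex \<open>v\<close> iff it is not just \<open>{v}\<close> and carries dilations about \<open>v\<close> that
  rescale distances as in the Euclidean plane. If \<open>X\<close> has such dilations, then pushing measures
  forward along them gives dilations of \<open>P2\<close> about a Dirac measure.

  Conversely, let \<open>P2\<close> have dilations about \<open>\<mu>\<close>. If \<open>W2 \<mu> \<nu> = W2 \<mu> \<delta>\<^sub>x + W2 \<delta>\<^sub>x \<nu>\<close>, then the product coupling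
  of \<open>\<mu>\<close> and \<open>\<nu>\<close> is optimal, so \<open>\<mu>\<close> and \<open>\<nu>\<close> live on spheres about \<open>x\<close> and almost all pairs of their
  points are joined through \<open>x\<close>. Taking for \<open>\<nu>\<close> the dilation of \<open>\<delta>\<^sub>x\<close> by the factor 2, \<open>\<mu>\<close> lives on a sphere about
  every \<open>x\<close> and hence is a Dirac measure. By uniqueness of geodesics from the vertex, dilations map
  Dirac measures to Dirac measures and so restrict to \<open>X\<close>. The same rigidity shows that
  branching of \<open>P2\<close> at \<open>\<delta>\<^sub>x\<close> is inherited from \<open>X\<close> at \<open>x\<close>.\<close>

section \<open>Cones as spaces with dilations\<close>

text \<open>The last clause is the law of cosines for \<open>D l x\<close> and \<open>D k y\<close>,
  with the angle eliminated by the law of cosines for \<open>x\<close> and \<open>y\<close>. Being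
  linear in squared distances, it can be integrated against couplings.\<close>

definition cone_dilation :: "'a set \<Rightarrow> ('a \<Rightarrow> 'a \<Rightarrow> real) \<Rightarrow> 'a \<Rightarrow> (real \<Rightarrow> 'a \<Rightarrow> 'a) \<Rightarrow> bool" where
  "cone_dilation M d v D \<longleftrightarrow>
     (\<forall>l\<ge>0. \<forall>x\<in>M. D l x \<in> M) \<and> (\<forall>x\<in>M. D 1 x = x) \<and>
     (\<forall>l\<ge>0. \<forall>k\<ge>0. \<forall>x\<in>M. \<forall>y\<in>M.
        (d (D l x) (D k y))\<^sup>2 =
        l * (l - k) * (d v x)\<^sup>2 + k * (k - l) * (d v y)\<^sup>2 + l * k * (d x y)\<^sup>2)"

locale dilated_space = Metric_space M d
  for M :: "'a set" and d :: "'a \<Rightarrow> 'a \<Rightarrow> real" and v :: 'a and D :: "real \<Rightarrow> 'a \<Rightarrow> 'a" +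
  assumes vertex_in [simp]: "v \<in> M"
    and dilation: "cone_dilation M d v D"
begin

lemma D_in [simp]: "0 \<le> l \<Longrightarrow> x \<in> M \<Longrightarrow> D l x \<in> M"
  using dilation by (auto simp: cone_dilation_def)

lemma D_1 [simp]: "x \<in> M \<Longrightarrow> D 1 x = x"
  using dilation by (auto simp: cone_dilation_def)

lemma D_dist_sq:
  assumes "0 \<le> l" "0 \<le> k" "x \<in> M" "y \<in> M"
  shows "(d (D l x) (D k y))\<^sup>2 =
    l * (l - k) * (d v x)\<^sup>2 + k * (k - l) * (d v y)\<^sup>2 + l * k * (d x y)\<^sup>2"
  using dilation assms by (auto simp: cone_dilation_def)

lemma D_0: "x \<in> M \<Longrightarrow> D 0 x = v"
  using D_dist_sq[of 0 1 x v] by simp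

lemma dist_D_D:
  assumes "0 \<le> l" "0 \<le> k" "x \<in> M"
  shows "d (D l x) (D k x) = \<bar>l - k\<bar> * d v x"
proof -
  have "(d (D l x) (D k x))\<^sup>2 = (\<bar>l - k\<bar> * d v x)\<^sup>2"
    using assms by (simp add: D_dist_sq power_mult_distrib) (simp add: power2_eq_square algebra_simps)
  then show ?thesis
    using assms by (simp add: power2_eq_iff_nonneg)
qed

lemma dist_vertex_D: "0 \<le> l \<Longrightarrow> x \<in> M \<Longrightarrow> d v (D l x) = l * d v x"
  using dist_D_D[of 0 l x] by (simp add: D_0)

lemma dist_D: "0 \<le> l \<Longrightarrow> x \<in> M \<Longrightarrow> d x (D l x) = \<bar>1 - l\<bar> * d v x"
  using dist_D_D[of 1 l x] by simp

lemma dist_D_same: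
  assumes "0 \<le> l" "x \<in> M" "y \<in> M"
  shows "d (D l x) (D l y) = l * d x y"
proof -
  have "(d (D l x) (D l y))\<^sup>2 = (l * d x y)\<^sup>2"
    using assms by (simp add: D_dist_sq power_mult_distrib) (simp add: power2_eq_square algebra_simps)
  then show ?thesis
    using assms by (simp add: power2_eq_iff_nonneg)
qed

lemma D_D:
  assumes "0 \<le> l" "0 \<le> k" "x \<in> M"
  shows "D l (D k x) = D (l * k) x"
proof -
  have "(d (D l (D k x)) (D (l * k) x))\<^sup>2 = 0"
    using assms
    by (simp add: D_dist_sq[where y = x] dist_vertex_D commute[of "D k x" x] dist_D power_mult_distrib)
       (simp add: power2_eq_square algebra_simps)
  then show ?thesis using assms by simp
qed

text \<open>Geodesics from the vertex are unique: with \<open>r = d v x\<close>, the dilation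
  formula for \<open>D 1 y\<close> and \<open>D s x\<close> gives \<open>(1 - s) * s^2 * r^2 + s *
  (s - 1) * r^2 + s * (1 - s)^2 * r^2 = 0\<close>.\<close>

lemma D_unique:
  assumes "0 \<le> s" "x \<in> M" "y \<in> M" "d v y = s * d v x" "d y x = (1 - s) * d v x"
  shows "y = D s x"
proof -
  have "(d (D 1 y) (D s x))\<^sup>2 = 0"
    using assms(1-3)
    by (simp only: D_dist_sq assms(4,5) zero_le_one) (simp add: power2_eq_square algebra_simps)
  then show ?thesis using assms by simp
qed

lemma inj_D: "0 < l \<Longrightarrow> inj_on (D l) M"
  using D_D[of "1 / l" l] by (intro inj_on_inverseI[where g = "D (1 / l)"]) simp

section \<open>Angles on the unit sphere about the vertex\<close>

definition unit_sphere :: "'a set" where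
  "unit_sphere = {x \<in> M. d v x = 1}"

text \<open>The apex angle of a Euclidean triangle with two unit legs and base
  \<open>d x y\<close>.\<close>

definition angle :: "'a \<Rightarrow> 'a \<Rightarrow> real" where
  "angle x y = arccos (1 - (d x y)\<^sup>2 / 2)"

lemma unit_sphere_dist_le: "x \<in> unit_sphere \<Longrightarrow> y \<in> unit_sphere \<Longrightarrow> d x y \<le> 2"
  using triangle[of x v y] by (auto simp: unit_sphere_def commute)

lemma angle_cos:
  assumes "x \<in> unit_sphere" "y \<in> unit_sphere"
  shows "0 \<le> angle x y" "angle x y \<le> pi" "cos (angle x y) = 1 - (d x y)\<^sup>2 / 2"
proof -
  have "(d x y)\<^sup>2 \<le> 2\<^sup>2"
    using unit_sphere_dist_le[OF assms] by (intro power_mono) auto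
  then have *: "-1 \<le> 1 - (d x y)\<^sup>2 / 2" "1 - (d x y)\<^sup>2 / 2 \<le> 1" by auto
  then show "0 \<le> angle x y" "angle x y \<le> pi" "cos (angle x y) = 1 - (d x y)\<^sup>2 / 2"
    unfolding angle_def by (auto intro: arccos_lbound arccos_ubound)
qed

lemma angle_eq_0: "x \<in> unit_sphere \<Longrightarrow> y \<in> unit_sphere \<Longrightarrow> angle x y = 0 \<longleftrightarrow> x = y"
  using angle_cos[of x y] by (auto simp: angle_def unit_sphere_def)

lemma D_dist_sq_cos:
  assumes "x \<in> unit_sphere" "y \<in> unit_sphere" "0 \<le> s" "0 \<le> t"
  shows "(d (D s x) (D t y))\<^sup>2 = s\<^sup>2 + t\<^sup>2 - 2 * s * t * cos (angle x y)"
  using assms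
  by (simp add: angle_cos D_dist_sq unit_sphere_def) (simp add: power2_eq_square algebra_simps)

text \<open>In the plane, the points with polar coordinates \<open>(sin \<beta>, - \<alpha>)\<close> and \<open>(sin \<alpha>, \<beta>)\<close> have the
  midpoint \<open>(sin (\<alpha> + \<beta>) / 2, 0)\<close>; comparing with the corresponding points of the cone
  turns the triangle inequality of \<open>d\<close> into that of the angle.\<close>

lemma angle_triangle:
  assumes x: "x \<in> unit_sphere" and y: "y \<in> unit_sphere" and z: "z \<in> unit_sphere"
  shows "angle x z \<le> angle x y + angle y z"
proof (cases "x = y \<or> y = z \<or> pi \<le> angle x y + angle y z")
  case True
  then show ?thesis
    using angle_cos[OF x y] angle_cos[OF y z] angle_cos[OF x z] by auto
next
  case False
  define a b where "a = angle x y" and "b = angle y z"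
  have ab: "0 < a" "0 < b" "a + b < pi"
    using False angle_cos[OF x y] angle_cos[OF y z] angle_eq_0[OF x y] angle_eq_0[OF y z]
    by (auto simp: a_def b_def)
  define s u t where "s = sin b" and "u = sin a" and "t = sin (a + b) / 2"
  have pos: "0 < s" "0 < u" "0 < t"
    using ab by (auto simp: s_def u_def t_def intro!: sin_gt_zero)
  have M: "D s x \<in> M" "D t y \<in> M" "D u z \<in> M"
    using x y z pos by (auto simp: unit_sphere_def)
  have "(d (D s x) (D u z))\<^sup>2 \<le> (d (D s x) (D t y) + d (D t y) (D u z))\<^sup>2"
    using triangle[OF M] by (intro power_mono) auto
  \<comment> \<open>In the planar model \<open>D t y\<close> is the midpoint, so both summands agree
    there and this bound loses nothing.\<close>
  also have "\<dots> \<le> 2 * ((d (D s x) (D t y))\<^sup>2 + (d (D t y) (D u z))\<^sup>2)"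
    using sum_squares_bound[of "d (D s x) (D t y)" "d (D t y) (D u z)"]
    by (simp add: power2_eq_square algebra_simps)
  finally have "s\<^sup>2 + u\<^sup>2 - 2 * s * u * cos (angle x z) \<le>
      2 * (s\<^sup>2 + t\<^sup>2 - 2 * s * t * cos a + (t\<^sup>2 + u\<^sup>2 - 2 * t * u * cos b))"
    using pos x y z by (simp add: D_dist_sq_cos a_def b_def)
  moreover have "s * cos a + u * cos b = 2 * t"
    by (simp add: s_def u_def t_def sin_add)
  then have "2 * (- 2 * s * t * cos a - 2 * t * u * cos b) = - 8 * t * t"
    by algebra
  ultimately have "- (2 * s * u * cos (angle x z)) \<le> s\<^sup>2 + u\<^sup>2 - 4 * t\<^sup>2"
    by (simp add: power2_eq_square)
  \<comment> \<open>In the plane, \<open>2 * t = sin (a + b)\<close> is the length of the sum of two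
    vectors of lengths \<open>s\<close> and \<open>u\<close> at angle \<open>a + b\<close>.\<close>
  also have "\<dots> = - (2 * s * u * cos (a + b))"
  proof -
    have "(sin a)\<^sup>2 + (cos a)\<^sup>2 = 1" "(sin b)\<^sup>2 + (cos b)\<^sup>2 = 1" by auto
    then show ?thesis
      unfolding s_def u_def t_def sin_add cos_add power_divide by algebra
  qed
  finally have "cos (a + b) \<le> cos (angle x z)"
    using pos by simp
  then show ?thesis
    using ab angle_cos[OF x z] cos_mono_le_eq[of "a + b" "angle x z"]
    by (auto simp: a_def b_def)
qed

text \<open>The locale demands nonnegativity also off the sphere, where \<open>arccos\<close> takes junk values; hence
  the absolute value.\<close>

lemma Metric_space_angle: "Metric_space unit_sphere (\<lambda>x y. \<bar>angle x y\<bar>)"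
proof
  show "\<bar>angle x y\<bar> = \<bar>angle y x\<bar>" for x y by (simp add: angle_def commute)
  show "\<bar>angle x z\<bar> \<le> \<bar>angle x y\<bar> + \<bar>angle y z\<bar>"
    if "x \<in> unit_sphere" "y \<in> unit_sphere" "z \<in> unit_sphere" for x y z
    using that angle_triangle angle_cos by simp
qed (auto simp: angle_eq_0)

text \<open>Each point goes to its polar coordinates: its rescaling to radius 1 is the direction,
  \<open>d v x\<close> the radius. The second point \<open>w\<close> guarantees that some direction
  exists.\<close>

lemma is_cone_vertex:
  assumes "w \<in> M" "w \<noteq> v"
  shows "is_cone_vertex M d v"
proof -
  \<comment> \<open>\<open>e\<close> serves as direction of the vertex, where every direction
    represents the same class.\<close>
  define e where "e = D (1 / d v w) w"
  have wpos: "0 < d v w" using assms by (metis mdist_pos_less vertex_in)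
  have e: "e \<in> unit_sphere"
    using wpos assms by (simp add: e_def unit_sphere_def dist_vertex_D)
  define dir where "dir x = (if x = v then e else D (1 / d v x) x)" for x
  define f where "f x = cone_rel unit_sphere `` {(dir x, d v x)}" for x
  let ?ang = "\<lambda>x y. \<bar>angle x y\<bar>"
  have dpos: "0 < d v x" if "x \<in> M" "x \<noteq> v" for x
    using that by (metis mdist_pos_less vertex_in)
  have dir: "dir x \<in> unit_sphere" if "x \<in> M" for x
    using that e dpos[of x] by (auto simp: dir_def unit_sphere_def dist_vertex_D)
  have D_dir: "D (d v x) (dir x) = x" if "x \<in> M" for x
    using that e dpos[of x] by (auto simp: dir_def D_0 D_D unit_sphere_def)
  have iso: "cone_dist ?ang (f x) (f y) = d x y" if "x \<in> M" "y \<in> M" for x y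
  proof -
    have "cone_dist ?ang (f x) (f y) = sqrt ((d (D (d v x) (dir x)) (D (d v y) (dir y)))\<^sup>2)"
      unfolding f_def using dir[OF that(1)] dir[OF that(2)] that
      by (subst cone_dist_class) (auto simp: cone_pre_dist_def D_dist_sq_cos angle_cos min_absorb1)
    then show ?thesis using that by (simp add: D_dir)
  qed
  have "inj_on f M"
  proof (rule inj_onI)
    fix x y assume "x \<in> M" "y \<in> M" "f x = f y"
    then have "d x y = d x x" using iso by metis
    then show "x = y" using \<open>x \<in> M\<close> \<open>y \<in> M\<close> by simp
  qed
  moreover have "f x \<in> metric_cone unit_sphere" if "x \<in> M" for x
    unfolding f_def metric_cone_def using dir that by (auto intro!: quotientI)
  moreover have "A \<in> f ` M" if A: "A \<in> metric_cone unit_sphere" for A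
  proof -
    obtain \<xi> s where p: "\<xi> \<in> unit_sphere" "0 \<le> s" "A = cone_rel unit_sphere `` {(\<xi>, s)}"
      using A by (auto simp: metric_cone_def elim!: quotientE)
    have \<xi>: "\<xi> \<in> M" "d v \<xi> = 1" using p by (auto simp: unit_sphere_def)
    have s: "d v (D s \<xi>) = s" using p \<xi> by (simp add: dist_vertex_D)
    have "f (D s \<xi>) = A"
    proof (cases "s = 0")
      case True
      then show ?thesis
        using p \<xi> e by (simp add: f_def D_0 dir_def cone_vertex_class)
    next
      case False
      then have "D s \<xi> \<noteq> v" using s mdist_zero[OF vertex_in] by metis
      then have "dir (D s \<xi>) = \<xi>"
        using p \<xi> s False by (simp add: dir_def D_D)
      then show ?thesis using p s by (simp add: f_def)
    qed
    then show ?thesis using \<xi> p by auto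
  qed
  ultimately have "bij_betw f M (metric_cone unit_sphere)"
    by (auto simp: bij_betw_def)
  then have "isometry_between f M d (metric_cone unit_sphere) (cone_dist ?ang)"
    using iso by (simp add: isometry_between_def)
  moreover have "f v = cone_vertex unit_sphere"
    using e by (simp add: f_def dir_def cone_vertex_class)
  ultimately show ?thesis
    using is_cone_vertexI[OF Metric_space_angle _ vertex_in] by blast
qed

end

section \<open>Dilations obtained from a cone structure\<close>

text \<open>\<open>D l\<close> multiplies the radius by \<open>l\<close> and keeps the direction.
  The point \<open>w\<close> has radius 1 over the direction of some representative of
  \<open>v\<close>.\<close>

lemma is_cone_vertexE:
  assumes met: "Metric_space M d" and "is_cone_vertex M d v"
  obtains D w where "dilated_space M d v D" "w \<in> M" "w \<noteq> v"
proof -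
  obtain \<Sigma> :: "'a set" and ang f where "Metric_space \<Sigma> ang"
    and iso: "isometry_between f M d (metric_cone \<Sigma>) (cone_dist ang)"
    and v: "v \<in> M" "f v = cone_vertex \<Sigma>"
    using assms(2) by (auto simp: is_cone_vertex_def)
  interpret Metric_space M d by fact
  have bij: "bij_betw f M (metric_cone \<Sigma>)"
    and dist: "\<And>x y. x \<in> M \<Longrightarrow> y \<in> M \<Longrightarrow> cone_dist ang (f x) (f y) = d x y"
    using iso by (auto simp: isometry_between_def)
  have "\<exists>\<xi> s. \<xi> \<in> \<Sigma> \<and> 0 \<le> s \<and> f x = cone_rel \<Sigma> `` {(\<xi>, s)}" if "x \<in> M" for x
  proof -
    have "f x \<in> metric_cone \<Sigma>" using bij that by (auto simp: bij_betw_def)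
    then show ?thesis by (fastforce simp: metric_cone_def elim!: quotientE)
  qed
  then obtain dir rad where rep:
    "\<And>x. x \<in> M \<Longrightarrow> dir x \<in> \<Sigma>" "\<And>x. x \<in> M \<Longrightarrow> 0 \<le> rad x"
    "\<And>x. x \<in> M \<Longrightarrow> f x = cone_rel \<Sigma> `` {(dir x, rad x)}"
    by metis
  define pt where "pt \<xi> s = inv_into M f (cone_rel \<Sigma> `` {(\<xi>, s)})" for \<xi> s
  have pt: "pt \<xi> s \<in> M" "f (pt \<xi> s) = cone_rel \<Sigma> `` {(\<xi>, s)}" if "\<xi> \<in> \<Sigma>" "0 \<le> s" for \<xi> s
  proof -
    have "cone_rel \<Sigma> `` {(\<xi>, s)} \<in> f ` M"
      using bij that by (auto simp: bij_betw_def metric_cone_def intro!: quotientI)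
    then show "pt \<xi> s \<in> M" "f (pt \<xi> s) = cone_rel \<Sigma> `` {(\<xi>, s)}"
      by (auto simp: pt_def inv_into_into f_inv_into_f)
  qed
  have pt_rep: "pt (dir x) (rad x) = x" if "x \<in> M" for x
    using that bij by (simp add: pt_def bij_betw_def flip: rep(3))
  have pt_dist: "(d (pt \<xi> s) (pt \<eta> t))\<^sup>2 = s\<^sup>2 + t\<^sup>2 - 2 * s * t * cos (min (ang \<xi> \<eta>) pi)"
    if "\<xi> \<in> \<Sigma>" "0 \<le> s" "\<eta> \<in> \<Sigma>" "0 \<le> t" for \<xi> s \<eta> t
  proof -
    \<comment> \<open>The radicand is at least \<open>(s - t)^2\<close>, hence nonnegative, so that
      squaring undoes \<open>sqrt\<close>.\<close>
    define c where "c = cos (min (ang \<xi> \<eta>) pi)"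
    have "s * t * c \<le> s * t * 1"
      using that by (intro mult_left_mono) (auto simp: c_def)
    moreover have "0 \<le> (s - t)\<^sup>2" by simp
    ultimately have "0 \<le> s\<^sup>2 + t\<^sup>2 - 2 * s * t * c"
      by (simp add: power2_eq_square algebra_simps)
    moreover have "d (pt \<xi> s) (pt \<eta> t) = sqrt (s\<^sup>2 + t\<^sup>2 - 2 * s * t * c)"
      using that pt cone_dist_class[of "(\<xi>, s)" \<Sigma> "(\<eta>, t)" ang]
      by (simp add: c_def cone_pre_dist_def flip: dist)
    ultimately show ?thesis by (simp add: c_def)
  qed
  have v_pt: "v = pt \<xi> 0" if "\<xi> \<in> \<Sigma>" for \<xi>
    using that bij v pt[of \<xi> 0]
    by (intro inj_onD[of f M]) (auto simp: cone_vertex_class bij_betw_def)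
  define D where "D l x = pt (dir x) (l * rad x)" for l x
  have dv: "(d v x)\<^sup>2 = (rad x)\<^sup>2" if "x \<in> M" for x
    using that rep[OF that] pt_dist[of "dir x" 0 "dir x" "rad x"]
    by (simp add: pt_rep flip: v_pt[of "dir x"])
  have dxy: "(d x y)\<^sup>2 = (rad x)\<^sup>2 + (rad y)\<^sup>2 - 2 * rad x * rad y * cos (min (ang (dir x) (dir y)) pi)"
    if "x \<in> M" "y \<in> M" for x y
    using that rep pt_dist[of "dir x" "rad x" "dir y" "rad y"] by (simp add: pt_rep)
  have "dilated_space M d v D"
  proof
    show "cone_dilation M d v D"
      unfolding cone_dilation_def
    proof (intro conjI allI impI ballI)
      fix l k :: real and x y assume *: "0 \<le> l" "0 \<le> k" "x \<in> M" "y \<in> M"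
      have "(d (D l x) (D k y))\<^sup>2 = (l * rad x)\<^sup>2 + (k * rad y)\<^sup>2 -
          2 * (l * rad x) * (k * rad y) * cos (min (ang (dir x) (dir y)) pi)"
        unfolding D_def using * rep by (intro pt_dist) auto
      then show "(d (D l x) (D k y))\<^sup>2 =
          l * (l - k) * (d v x)\<^sup>2 + k * (k - l) * (d v y)\<^sup>2 + l * k * (d x y)\<^sup>2"
        using * by (simp add: dv dxy) (simp add: power2_eq_square algebra_simps)
    qed (use rep pt pt_rep in \<open>auto simp: D_def\<close>)
  qed (use v in auto)
  moreover have "dir v \<in> \<Sigma>" using rep v by auto
  then have "pt (dir v) 1 \<in> M" "d v (pt (dir v) 1) \<noteq> 0"
    using pt pt_dist[of "dir v" 0 "dir v" 1] by (auto simp flip: v_pt)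
  ultimately show thesis using that v by auto
qed

text \<open>The cone over the empty set is empty and has no vertex. A nonempty \<open>M\<close>
  excludes this base, so the vertex class has a preimage.\<close>

lemma has_cone_structure_iff:
  assumes "M \<noteq> {}"
  shows "has_cone_structure M d \<longleftrightarrow> (\<exists>v. is_cone_vertex M d v)"
proof
  assume "has_cone_structure M d"
  then obtain \<Sigma> :: "'a set" and ang f where met: "Metric_space \<Sigma> ang"
    and iso: "isometry_between f M d (metric_cone \<Sigma>) (cone_dist ang)"
    by (auto simp: has_cone_structure_def)
  then have fM: "f ` M = metric_cone \<Sigma>"
    by (auto simp: isometry_between_def bij_betw_def)
  then have "metric_cone \<Sigma> \<noteq> {}" using assms by auto
  then obtain \<xi> where "\<xi> \<in> \<Sigma>"
    by (auto simp: metric_cone_def quotient_def)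
  then have "cone_vertex \<Sigma> \<in> metric_cone \<Sigma>"
    unfolding metric_cone_def by (subst cone_vertex_class[symmetric]) (auto intro!: quotientI)
  then obtain v where "v \<in> M" "f v = cone_vertex \<Sigma>"
    using fM by (metis imageE)
  then show "\<exists>v. is_cone_vertex M d v"
    using met iso by (auto simp: is_cone_vertex_def)
qed (auto simp: has_cone_structure_def is_cone_vertex_def)

section \<open>Change of vertex\<close>

text \<open>A similarity multiplies all terms of the branching equalities by \<open>c\<close>, and
  injectivity brings the conclusion back.\<close>

lemma non_branching_at_similarity:
  assumes h: "h ` M \<subseteq> M" "inj_on h M" "\<And>x y. x \<in> M \<Longrightarrow> y \<in> M \<Longrightarrow> d (h x) (h y) = c * d x y"
    and x: "x \<in> M" and nb: "non_branching_at M d (h x)"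
  shows "non_branching_at M d x"
  unfolding non_branching_at_def
proof (intro ballI impI)
  fix u v w assume M: "u \<in> M" "v \<in> M" "w \<in> M" "u \<noteq> x"
    and eq: "d u v = d u x + d x v \<and> d u x + d x v = d u x + d x w \<and> d u x + d x w = d u w"
  have "h u \<noteq> h x" using M x h(2) by (meson inj_onD)
  moreover have "d (h u) (h v) = d (h u) (h x) + d (h x) (h v) \<and>
      d (h u) (h x) + d (h x) (h v) = d (h u) (h x) + d (h x) (h w) \<and>
      d (h u) (h x) + d (h x) (h w) = d (h u) (h w)"
  proof -
    have "d u v = d u x + d x v" "d x w = d x v" "d u w = d u x + d x v" using eq by auto
    then show ?thesis using M x by (simp only: h(3)) (simp add: distrib_left)
  qed
  moreover have "h u \<in> M" "h v \<in> M" "h w \<in> M" using M h(1) by auto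
  ultimately have "h v = h w" using nb unfolding non_branching_at_def by blast
  then show "v = w" using M h(2) by (meson inj_onD)
qed

text \<open>The point \<open>p\<close> extending the segment from \<open>v\<close> to \<open>v'\<close> by its own length is a vertex as well,
  and the contraction towards \<open>p\<close> by \<open>1/2\<close> maps \<open>v\<close> to \<open>v'\<close>.\<close>

lemma non_branching_at_vertices:
  assumes "dilated_space M d v D" "dilated_space M d v' D'" "non_branching_at M d v'"
  shows "non_branching_at M d v"
proof -
  interpret A: dilated_space M d v D by fact
  interpret B: dilated_space M d v' D' by fact
  \<comment> \<open>\<open>E\<close> is \<open>D'\<close> conjugated by the similarity
    \<open>D 2\<close> with inverse \<open>D (1/2)\<close>; its centre is therefore
    \<open>D 2 v' = p\<close> instead of \<open>v'\<close>.\<close>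
  define E where "E l x = D 2 (D' l (D (1/2) x))" for l x
  define p where "p = D 2 v'"
  interpret E: dilated_space M d p E
  proof
    show "cone_dilation M d p E"
      unfolding cone_dilation_def
    proof (intro conjI allI impI ballI)
      fix l k :: real and x y assume *: "0 \<le> l" "0 \<le> k" "x \<in> M" "y \<in> M"
      have half: "d a b = 2 * d (D (1/2) a) (D (1/2) b)" if "a \<in> M" "b \<in> M" for a b
        using that by (simp add: A.dist_D_same)
      have p: "D (1/2) p = v'" "p \<in> M" by (simp_all add: p_def A.D_D)
      show "(d (E l x) (E k y))\<^sup>2 =
          l * (l - k) * (d p x)\<^sup>2 + k * (k - l) * (d p y)\<^sup>2 + l * k * (d x y)\<^sup>2"
      proof -
        have "(d (E l x) (E k y))\<^sup>2 = 4 * (d (D' l (D (1/2) x)) (D' k (D (1/2) y)))\<^sup>2"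
          using * by (simp add: E_def A.dist_D_same power_mult_distrib)
        also have "\<dots> = l * (l - k) * (2 * d v' (D (1/2) x))\<^sup>2 + k * (k - l) * (2 * d v' (D (1/2) y))\<^sup>2
            + l * k * (2 * d (D (1/2) x) (D (1/2) y))\<^sup>2"
          using * by (simp add: B.D_dist_sq power_mult_distrib)
        finally show ?thesis
          by (simp only: half[OF p(2) *(3)] half[OF p(2) *(4)] half[OF *(3,4)] p(1))
      qed
    qed (simp_all add: E_def A.D_D)
  qed (simp add: p_def)
  \<comment> \<open>\<open>v'\<close> is the midpoint of \<open>v\<close> and \<open>p\<close>,
    hence the contraction of \<open>v\<close> towards \<open>p\<close> by uniqueness of geodesics
    from \<open>p\<close>.\<close>
  have "d p v' = d v v'" "d p v = 2 * d v v'"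
    using A.dist_D[of 2 v'] A.dist_vertex_D[of 2 v']
    by (simp_all add: p_def A.commute[of "D 2 v'"])
  then have h: "v' = E (1/2) v"
    by (intro E.D_unique) (simp_all add: A.commute[of v' v])
  show ?thesis
  proof (rule non_branching_at_similarity[where c = "1 / 2"])
    show "E (1/2) ` M \<subseteq> M" by (intro image_subsetI E.D_in) simp_all
    show "inj_on (E (1/2)) M" by (rule E.inj_D) simp
    show "non_branching_at M d (E (1/2) v)" using assms(3) by (simp only: h[symmetric])
  qed (simp_all add: E.dist_D_same)
qed

section \<open>The Wasserstein distance as a metric\<close>

text \<open>Membership in \<open>P2\<close> gives a second moment about one point;
  \<open>(a + b)^2 \<le> 2 * a^2 + 2 * b^2\<close> moves it to any \<open>x0\<close>.\<close>

lemma P2D: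
  fixes \<mu> :: "'a::polish_space measure"
  assumes "\<mu> \<in> P2"
  shows "sets \<mu> = sets borel" "space \<mu> = UNIV" "prob_space \<mu>"
    and "integrable \<mu> (\<lambda>x. (dist x0 x)\<^sup>2)"
proof -
  show [measurable_cong]: "sets \<mu> = sets borel" and "prob_space \<mu>"
    using assms by (auto simp: P2_def)
  then show "space \<mu> = UNIV" using sets_eq_imp_space_eq by fastforce
  interpret prob_space \<mu> by fact
  obtain x1 where "(\<integral>\<^sup>+ x. ennreal ((dist x1 x)\<^sup>2) \<partial>\<mu>) < \<infinity>"
    using assms by (auto simp: P2_def)
  then have "integrable \<mu> (\<lambda>x. (dist x1 x)\<^sup>2)"
    by (intro integrableI_nonneg) auto
  then have "integrable \<mu> (\<lambda>x. 2 * (dist x0 x1)\<^sup>2 + 2 * (dist x1 x)\<^sup>2)" by auto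
  then show "integrable \<mu> (\<lambda>x. (dist x0 x)\<^sup>2)"
  proof (rule Bochner_Integration.integrable_bound)
    have "(dist x0 x)\<^sup>2 \<le> 2 * (dist x0 x1)\<^sup>2 + 2 * (dist x1 x)\<^sup>2" for x
    proof -
      have "(dist x0 x)\<^sup>2 \<le> (dist x0 x1 + dist x1 x)\<^sup>2"
        by (intro power_mono dist_triangle) auto
      then show ?thesis
        using sum_squares_bound[of "dist x0 x1" "dist x1 x"] by (simp add: power2_sum)
    qed
    then show "AE x in \<mu>. norm ((dist x0 x)\<^sup>2) \<le> norm (2 * (dist x0 x1)\<^sup>2 + 2 * (dist x1 x)\<^sup>2)"
      by auto
  qed auto
qed

lemma P2I:
  fixes \<mu> :: "'a::polish_space measure"
  assumes "sets \<mu> = sets borel" "prob_space \<mu>" "integrable \<mu> (\<lambda>x. (dist x0 x)\<^sup>2)"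
  shows "\<mu> \<in> P2"
  using assms nn_integral_eq_integral[OF assms(3)] unfolding P2_def by (auto intro!: exI[of _ x0])

text \<open>By second countability the Borel sets of the product form the product sigma-algebra, to
  which Fubini and the measurability of projections apply.\<close>

lemma couplings_iff:
  fixes \<mu> :: "'a::polish_space measure"
  shows "\<pi> \<in> couplings \<mu> \<nu> \<longleftrightarrow> sets \<pi> = sets (borel \<Otimes>\<^sub>M borel) \<and> prob_space \<pi> \<and>
    distr \<pi> borel fst = \<mu> \<and> distr \<pi> borel snd = \<nu>"
  unfolding couplings_def borel_prod by simp

text \<open>A real-valued Bochner integral, which allows subtraction; for couplings of measures in
  \<open>P2\<close> it equals the integral in \<open>W2\<close>, as \<open>nn_integral_cost\<close>
  shows.\<close>

definition cost :: "('a::metric_space \<times> 'a) measure \<Rightarrow> real" where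
  "cost \<pi> = (\<integral>p. (dist (fst p) (snd p))\<^sup>2 \<partial>\<pi>)"

lemma coupling_integral:
  fixes f :: "'a::polish_space \<Rightarrow> real"
  assumes \<pi>: "\<pi> \<in> couplings \<mu> \<nu>" and [measurable]: "f \<in> borel_measurable borel"
  shows "integrable \<pi> (\<lambda>p. f (fst p)) \<longleftrightarrow> integrable \<mu> f"
    and "integrable \<pi> (\<lambda>p. f (snd p)) \<longleftrightarrow> integrable \<nu> f"
    and "(\<integral>p. f (fst p) \<partial>\<pi>) = (\<integral>x. f x \<partial>\<mu>)"
    and "(\<integral>p. f (snd p) \<partial>\<pi>) = (\<integral>x. f x \<partial>\<nu>)"
proof -
  have [measurable_cong]: "sets \<pi> = sets (borel \<Otimes>\<^sub>M borel)"
    and \<mu>: "\<mu> = distr \<pi> borel fst" and \<nu>: "\<nu> = distr \<pi> borel snd"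
    using \<pi> by (auto simp: couplings_iff)
  show "integrable \<pi> (\<lambda>p. f (fst p)) \<longleftrightarrow> integrable \<mu> f"
    "(\<integral>p. f (fst p) \<partial>\<pi>) = (\<integral>x. f x \<partial>\<mu>)"
    unfolding \<mu> by (simp_all add: integrable_distr_eq integral_distr)
  show "integrable \<pi> (\<lambda>p. f (snd p)) \<longleftrightarrow> integrable \<nu> f"
    "(\<integral>p. f (snd p) \<partial>\<pi>) = (\<integral>x. f x \<partial>\<nu>)"
    unfolding \<nu> by (simp_all add: integrable_distr_eq integral_distr)
qed

lemma integrable_cost:
  fixes \<mu> :: "'a::polish_space measure"
  assumes \<pi>: "\<pi> \<in> couplings \<mu> \<nu>" and P2: "\<mu> \<in> P2" "\<nu> \<in> P2"
  shows "integrable \<pi> (\<lambda>p. (dist (fst p) (snd p))\<^sup>2)"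
proof -
  have [measurable_cong]: "sets \<pi> = sets (borel \<Otimes>\<^sub>M borel)"
    using \<pi> by (auto simp: couplings_iff)
  fix o' :: 'a
  have "integrable \<pi> (\<lambda>p. (dist o' (fst p))\<^sup>2)" "integrable \<pi> (\<lambda>p. (dist o' (snd p))\<^sup>2)"
    using P2D(4)[OF P2(1)] P2D(4)[OF P2(2)] by (simp_all add: coupling_integral[OF \<pi>, where f = "\<lambda>x. (dist o' x)\<^sup>2"])
  then have "integrable \<pi> (\<lambda>p. 2 * (dist o' (fst p))\<^sup>2 + 2 * (dist o' (snd p))\<^sup>2)" by auto
  then show ?thesis
  proof (rule Bochner_Integration.integrable_bound)
    have "(dist x y)\<^sup>2 \<le> 2 * (dist o' x)\<^sup>2 + 2 * (dist o' y)\<^sup>2" for x y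
    proof -
      have "(dist x y)\<^sup>2 \<le> (dist o' x + dist o' y)\<^sup>2"
        by (intro power_mono dist_triangle3) auto
      then show ?thesis
        using sum_squares_bound[of "dist o' x" "dist o' y"] by (simp add: power2_sum)
    qed
    then show "AE p in \<pi>. norm ((dist (fst p) (snd p))\<^sup>2) \<le>
        norm (2 * (dist o' (fst p))\<^sup>2 + 2 * (dist o' (snd p))\<^sup>2)"
      by auto
  qed auto
qed

lemma nn_integral_cost:
  fixes \<mu> :: "'a::polish_space measure"
  assumes "\<pi> \<in> couplings \<mu> \<nu>" "\<mu> \<in> P2" "\<nu> \<in> P2"
  shows "(\<integral>\<^sup>+ (x, y). ennreal ((dist x y)\<^sup>2) \<partial>\<pi>) = ennreal (cost \<pi>)"
  using nn_integral_eq_integral[OF integrable_cost[OF assms]]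
  by (simp add: cost_def split_beta')

lemma cost_nonneg: "0 \<le> cost \<pi>"
  by (simp add: cost_def)

lemma W2_nonneg: "0 \<le> W2 \<mu> \<nu>"
  by (simp add: W2_def)

lemma W2_sq_le_cost:
  fixes \<mu> :: "'a::polish_space measure"
  assumes "\<pi> \<in> couplings \<mu> \<nu>" "\<mu> \<in> P2" "\<nu> \<in> P2"
  shows "(W2 \<mu> \<nu>)\<^sup>2 \<le> cost \<pi>"
proof -
  have "(INF \<pi>\<in>couplings \<mu> \<nu>. \<integral>\<^sup>+ (x, y). ennreal ((dist x y)\<^sup>2) \<partial>\<pi>) \<le> ennreal (cost \<pi>)"
    using assms(1) by (rule INF_lower2) (simp add: nn_integral_cost[OF assms])
  then have "enn2real (INF \<pi>\<in>couplings \<mu> \<nu>. \<integral>\<^sup>+ (x, y). ennreal ((dist x y)\<^sup>2) \<partial>\<pi>) \<le> cost \<pi>"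
    using enn2real_mono[of _ "ennreal (cost \<pi>)"] by (simp add: cost_nonneg)
  then show ?thesis by (simp add: W2_def)
qed

lemma pair_measure_coupling:
  fixes \<mu> :: "'a::polish_space measure"
  assumes P2: "\<mu> \<in> P2" "\<nu> \<in> P2"
  shows "\<mu> \<Otimes>\<^sub>M \<nu> \<in> couplings \<mu> \<nu>"
proof -
  note [measurable_cong] = P2D(1)[OF P2(1)] P2D(1)[OF P2(2)]
  interpret M: prob_space \<mu> by (rule P2D P2)+
  interpret N: prob_space \<nu> by (rule P2D P2)+
  interpret pair_prob_space \<mu> \<nu> ..
  have "distr (\<mu> \<Otimes>\<^sub>M \<nu>) borel fst = \<mu>"
  proof (rule measure_eqI)
    fix A assume A: "A \<in> sets (distr (\<mu> \<Otimes>\<^sub>M \<nu>) borel fst)"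
    have "emeasure (\<mu> \<Otimes>\<^sub>M \<nu>) (A \<times> UNIV) = emeasure \<mu> A"
      using A N.emeasure_pair_measure_Times[of A \<mu> UNIV] N.emeasure_space_1
      by (simp add: P2D[OF P2(1)] P2D[OF P2(2)])
    moreover have "fst -` A \<inter> space (\<mu> \<Otimes>\<^sub>M \<nu>) = A \<times> UNIV"
      by (auto simp: space_pair_measure P2D[OF P2(1)] P2D[OF P2(2)])
    ultimately show "emeasure (distr (\<mu> \<Otimes>\<^sub>M \<nu>) borel fst) A = emeasure \<mu> A"
      using A by (simp add: emeasure_distr)
  qed (simp add: P2D[OF P2(1)])
  moreover have "distr (\<mu> \<Otimes>\<^sub>M \<nu>) borel snd = \<nu>"
  proof (rule measure_eqI)
    fix A assume A: "A \<in> sets (distr (\<mu> \<Otimes>\<^sub>M \<nu>) borel snd)"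
    have "emeasure (\<mu> \<Otimes>\<^sub>M \<nu>) (UNIV \<times> A) = emeasure \<nu> A"
      using A N.emeasure_pair_measure_Times[of UNIV \<mu> A] M.emeasure_space_1
      by (simp add: P2D[OF P2(1)] P2D[OF P2(2)])
    moreover have "snd -` A \<inter> space (\<mu> \<Otimes>\<^sub>M \<nu>) = UNIV \<times> A"
      by (auto simp: space_pair_measure P2D[OF P2(1)] P2D[OF P2(2)])
    ultimately show "emeasure (distr (\<mu> \<Otimes>\<^sub>M \<nu>) borel snd) A = emeasure \<nu> A"
      using A by (simp add: emeasure_distr)
  qed (simp add: P2D[OF P2(2)])
  moreover have "sets (\<mu> \<Otimes>\<^sub>M \<nu>) = sets (borel \<Otimes>\<^sub>M borel)"
    by (intro sets_pair_measure_cong P2D P2)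
  moreover have "prob_space (\<mu> \<Otimes>\<^sub>M \<nu>)" by (rule P.prob_space_axioms)
  ultimately show ?thesis by (simp add: couplings_iff)
qed

text \<open>The later arguments work with these couplings of almost minimal cost in place of
  minimizers.\<close>

lemma W2_less_couplingE:
  fixes \<mu> :: "'a::polish_space measure"
  assumes P2: "\<mu> \<in> P2" "\<nu> \<in> P2" and A: "W2 \<mu> \<nu> < A"
  obtains \<pi> where "\<pi> \<in> couplings \<mu> \<nu>" "cost \<pi> < A\<^sup>2"
proof -
  let ?I = "INF \<pi>\<in>couplings \<mu> \<nu>. \<integral>\<^sup>+ (x, y). ennreal ((dist x y)\<^sup>2) \<partial>\<pi>"
  \<comment> \<open>The product coupling keeps the infimum finite; at infinity
    \<open>enn2real\<close> would return 0.\<close>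
  have "?I \<le> ennreal (cost (\<mu> \<Otimes>\<^sub>M \<nu>))"
    using pair_measure_coupling[OF P2] by (rule INF_lower2) (simp add: nn_integral_cost[OF pair_measure_coupling] P2)
  then have "?I < \<infinity>"
    by (rule le_less_trans) simp
  then have "?I = ennreal ((W2 \<mu> \<nu>)\<^sup>2)"
    by (simp add: W2_def less_top)
  also have "\<dots> < ennreal (A\<^sup>2)"
    using A W2_nonneg[of \<mu> \<nu>] by (intro ennreal_lessI power_strict_mono) auto
  finally obtain \<pi> where \<pi>: "\<pi> \<in> couplings \<mu> \<nu>" "(\<integral>\<^sup>+ (x, y). ennreal ((dist x y)\<^sup>2) \<partial>\<pi>) < ennreal (A\<^sup>2)"
    by (auto simp: INF_less_iff)
  then have "cost \<pi> < A\<^sup>2"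
    by (simp add: nn_integral_cost[OF \<pi>(1) P2] ennreal_less_iff cost_nonneg)
  then show thesis using that \<pi> by blast
qed

lemma distr_coupling:
  fixes \<mu> :: "'a::polish_space measure" and T S :: "'a \<Rightarrow> 'a"
  assumes \<pi>: "\<pi> \<in> couplings \<mu> \<nu>"
    and [measurable]: "T \<in> borel \<rightarrow>\<^sub>M borel" "S \<in> borel \<rightarrow>\<^sub>M borel"
  defines "\<pi>' \<equiv> distr \<pi> (borel \<Otimes>\<^sub>M borel) (\<lambda>p. (T (fst p), S (snd p)))"
  shows "\<pi>' \<in> couplings (distr \<mu> borel T) (distr \<nu> borel S)"
    and "cost \<pi>' = (\<integral>p. (dist (T (fst p)) (S (snd p)))\<^sup>2 \<partial>\<pi>)"
proof -
  have [measurable_cong]: "sets \<pi> = sets (borel \<Otimes>\<^sub>M borel)" and "prob_space \<pi>"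
    and \<mu>: "\<mu> = distr \<pi> borel fst" and \<nu>: "\<nu> = distr \<pi> borel snd"
    using \<pi> by (auto simp: couplings_iff)
  interpret prob_space \<pi> by fact
  have "prob_space \<pi>'" unfolding \<pi>'_def by (rule prob_space_distr) measurable
  then show "\<pi>' \<in> couplings (distr \<mu> borel T) (distr \<nu> borel S)"
    unfolding couplings_iff \<mu> \<nu> \<pi>'_def by (simp add: distr_distr comp_def)
  show "cost \<pi>' = (\<integral>p. (dist (T (fst p)) (S (snd p)))\<^sup>2 \<partial>\<pi>)"
    unfolding cost_def \<pi>'_def by (subst integral_distr) simp_all
qed

lemma W2_commute: "W2 \<mu> \<nu> = W2 \<nu> (\<mu> :: 'a::polish_space measure)"
proof -
  have "(INF \<pi>\<in>couplings \<mu> \<nu>. \<integral>\<^sup>+ (x, y). ennreal ((dist x y)\<^sup>2) \<partial>\<pi>) \<le>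
      (INF \<pi>\<in>couplings \<nu> \<mu>. \<integral>\<^sup>+ (x, y). ennreal ((dist x y)\<^sup>2) \<partial>\<pi>)" for \<mu> \<nu> :: "'a measure"
  proof (rule INF_greatest)
    fix \<pi> assume \<pi>: "\<pi> \<in> couplings \<nu> \<mu>"
    have [measurable_cong]: "sets \<pi> = sets (borel \<Otimes>\<^sub>M borel)" and "prob_space \<pi>"
      using \<pi> by (auto simp: couplings_iff)
    let ?\<pi> = "distr \<pi> (borel \<Otimes>\<^sub>M borel) (\<lambda>p. (snd p, fst p))"
    interpret prob_space \<pi> by fact
    have "prob_space ?\<pi>" by (rule prob_space_distr) measurable
    then have "?\<pi> \<in> couplings \<mu> \<nu>"
      using \<pi> unfolding couplings_iff by (simp add: distr_distr comp_def)
    moreover have "(\<integral>\<^sup>+ (x, y). ennreal ((dist x y)\<^sup>2) \<partial>?\<pi>) = (\<integral>\<^sup>+ (x, y). ennreal ((dist x y)\<^sup>2) \<partial>\<pi>)"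
      by (subst nn_integral_distr) (auto simp: split_beta' dist_commute)
    ultimately show "(INF \<pi>\<in>couplings \<mu> \<nu>. \<integral>\<^sup>+ (x, y). ennreal ((dist x y)\<^sup>2) \<partial>\<pi>) \<le>
        (\<integral>\<^sup>+ (x, y). ennreal ((dist x y)\<^sup>2) \<partial>\<pi>)"
      by (intro INF_lower2) auto
  qed
  from antisym[OF this[of \<mu> \<nu>] this[of \<nu> \<mu>]] show ?thesis by (simp only: W2_def)
qed

section \<open>Distances from Dirac measures\<close>

lemma return_P2: "return borel (x :: 'a::polish_space) \<in> P2"
  by (intro P2I[of _ x]) (auto simp: prob_space_return integrable_iff_bounded nn_integral_return)

text \<open>Every coupling with the Dirac measure at \<open>x\<close> has first coordinate
  \<open>x\<close> almost everywhere, so all couplings have the same cost.\<close>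

lemma W2_return_sq:
  fixes \<nu> :: "'a::polish_space measure"
  assumes \<nu>: "\<nu> \<in> P2"
  shows "(W2 (return borel x) \<nu>)\<^sup>2 = (\<integral>y. (dist x y)\<^sup>2 \<partial>\<nu>)"
proof -
  define \<mu> where "\<mu> = return borel x"
  have P2: "\<mu> \<in> P2" by (simp add: \<mu>_def return_P2)
  have cost: "cost \<pi> = (\<integral>y. (dist x y)\<^sup>2 \<partial>\<nu>)" if \<pi>: "\<pi> \<in> couplings \<mu> \<nu>" for \<pi>
  proof -
    have [measurable_cong]: "sets \<pi> = sets (borel \<Otimes>\<^sub>M borel)" and "distr \<pi> borel fst = \<mu>"
      using \<pi> by (auto simp: couplings_iff)
    then have "AE y in distr \<pi> borel fst. y = x"
      by (simp only: \<mu>_def) (subst AE_return, auto)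
    then have "AE p in \<pi>. fst p = x"
      by (subst (asm) AE_distr_iff) auto
    then have "cost \<pi> = (\<integral>p. (dist x (snd p))\<^sup>2 \<partial>\<pi>)"
      unfolding cost_def by (intro integral_cong_AE) auto
    then show ?thesis
      using coupling_integral(4)[OF \<pi>, of "\<lambda>y. (dist x y)\<^sup>2"] by simp
  qed
  have "(W2 \<mu> \<nu>)\<^sup>2 \<le> (\<integral>y. (dist x y)\<^sup>2 \<partial>\<nu>)"
    using W2_sq_le_cost[OF pair_measure_coupling P2 \<nu>] cost[OF pair_measure_coupling] P2 \<nu> by auto
  moreover have "(\<integral>y. (dist x y)\<^sup>2 \<partial>\<nu>) \<le> (W2 \<mu> \<nu>)\<^sup>2"
  proof (rule ccontr)
    assume "\<not> ?thesis"
    then have "W2 \<mu> \<nu> < sqrt (\<integral>y. (dist x y)\<^sup>2 \<partial>\<nu>)"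
      by (intro real_less_rsqrt) simp
    then obtain \<pi> where "\<pi> \<in> couplings \<mu> \<nu>" "cost \<pi> < (sqrt (\<integral>y. (dist x y)\<^sup>2 \<partial>\<nu>))\<^sup>2"
      using W2_less_couplingE P2 \<nu> by blast
    then show False by (simp add: cost)
  qed
  ultimately show ?thesis by (simp add: \<mu>_def)
qed

lemma W2_return_return: "W2 (return borel x) (return borel (y :: 'a::polish_space)) = dist x y"
proof -
  have "(W2 (return borel x) (return borel y))\<^sup>2 = (dist x y)\<^sup>2"
    by (subst W2_return_sq[OF return_P2]) (simp add: integral_return)
  then show ?thesis by (simp add: power2_eq_iff_nonneg W2_nonneg)
qed

lemma eq_return:
  fixes \<mu> :: "'a::polish_space measure"
  assumes \<mu>: "\<mu> \<in> P2" and AE: "AE y in \<mu>. y = x"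
  shows "\<mu> = return borel x"
proof (rule measure_eqI)
  note [measurable_cong] = P2D(1)[OF \<mu>]
  interpret prob_space \<mu> by (rule P2D \<mu>)+
  fix A assume A: "A \<in> sets \<mu>"
  have "emeasure \<mu> A = emeasure \<mu> (if x \<in> A then space \<mu> else {})"
    using A AE by (intro emeasure_eq_AE) auto
  then show "emeasure \<mu> A = emeasure (return borel x) A"
    using A emeasure_space_1 by (auto simp: P2D[OF \<mu>] split: if_splits)
qed (simp add: P2D[OF \<mu>])

lemma coupling_AE:
  fixes \<mu> :: "'a::polish_space measure"
  assumes \<pi>: "\<pi> \<in> couplings \<mu> \<nu>" and [measurable]: "Measurable.pred borel P"
  shows "(AE p in \<pi>. P (snd p)) \<longleftrightarrow> (AE y in \<nu>. P y)"
    and "(AE p in \<pi>. P (fst p)) \<longleftrightarrow> (AE y in \<mu>. P y)"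
proof -
  have [measurable_cong]: "sets \<pi> = sets (borel \<Otimes>\<^sub>M borel)"
    and \<mu>: "\<mu> = distr \<pi> borel fst" and \<nu>: "\<nu> = distr \<pi> borel snd"
    using \<pi> by (auto simp: couplings_iff)
  show "(AE p in \<pi>. P (snd p)) \<longleftrightarrow> (AE y in \<nu>. P y)"
    unfolding \<nu> by (subst AE_distr_iff) auto
  show "(AE p in \<pi>. P (fst p)) \<longleftrightarrow> (AE y in \<mu>. P y)"
    unfolding \<mu> by (subst AE_distr_iff) auto
qed

section \<open>Gluing of couplings and the triangle inequality\<close>

text \<open>The cell of \<open>x\<close> is the first index of a dense sequence at which the
  distance from \<open>x\<close> is below \<open>E / 2\<close>; points of one cell are close to the
  same member.\<close>

lemma small_cells:
  fixes E :: real
  assumes "0 < E"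
  obtains k :: "'a::polish_space \<Rightarrow> nat"
  where "k \<in> borel \<rightarrow>\<^sub>M count_space UNIV" "\<And>x y. k x = k y \<Longrightarrow> dist x y \<le> E"
proof -
  obtain Q :: "'a set" where Q: "countable Q" "\<And>X. open X \<Longrightarrow> X \<noteq> {} \<Longrightarrow> \<exists>d \<in> Q. d \<in> X"
    by (rule countable_dense_setE) blast
  define q where "q = from_nat_into Q"
  have ex: "\<exists>n. dist x (q n) < E / 2" for x
  proof -
    have "\<exists>d\<in>Q. d \<in> ball x (E / 2)" using assms by (intro Q) auto
    then obtain d where "d \<in> Q" "dist x d < E / 2" by auto
    moreover from this obtain n where "q n = d"
      using from_nat_into_surj[OF Q(1)] by (metis q_def)
    ultimately show ?thesis by auto
  qed
  define k where "k x = (LEAST n. dist x (q n) < E / 2)" for x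
  have k: "dist x (q (k x)) < E / 2" for x
    unfolding k_def using ex by (rule LeastI_ex)
  have "k \<in> borel \<rightarrow>\<^sub>M count_space UNIV"
    unfolding k_def by measurable
  moreover have "dist x y \<le> E" if "k x = k y" for x y
    using k[of x] k[of y] that dist_triangle2[of x y "q (k x)"] by simp
  ultimately show thesis using that by blast
qed

text \<open>Cauchy-Schwarz with its defect as an explicit square; the defect supplies the equality
  case needed for rigidity.\<close>

lemma weighted_square_le:
  fixes a b A B :: real
  assumes "0 < A" "0 < B"
  shows "(a + b)\<^sup>2 + (B * a - A * b)\<^sup>2 / (A * B) = (A + B) * (a\<^sup>2 / A + b\<^sup>2 / B)"
  using assms by (simp add: field_simps power2_eq_square)

text \<open>With \<open>A\<close>, \<open>B\<close>, \<open>E\<close> bounding the L2 norms of the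
  three terms, integration yields Minkowski's bound \<open>(A + B + E)^2\<close>.\<close>

lemma weighted_square_le3:
  fixes a b e A B E :: real
  assumes "0 < A" "0 < B" "0 < E"
  shows "(a + b + e)\<^sup>2 \<le> (A + B + E) * (a\<^sup>2 / A + b\<^sup>2 / B + e\<^sup>2 / E)"
proof -
  have "(a + b + e)\<^sup>2 \<le> (A + B + E) * ((a + b)\<^sup>2 / (A + B) + e\<^sup>2 / E)"
    using assms by (subst weighted_square_le[symmetric]) auto
  also have "(a + b)\<^sup>2 / (A + B) \<le> a\<^sup>2 / A + b\<^sup>2 / B"
    using assms weighted_square_le[of A B a b] by (simp add: pos_divide_le_eq mult.commute)
      (smt (verit) divide_nonneg_pos mult_pos_pos zero_le_power2)
  finally show ?thesis using assms by simp
qed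

text \<open>Instead of disintegrating over the common marginal \<open>\<nu>\<close>, the two couplings are glued only
  along a countable partition into cells of small diameter, by reweighting their product.\<close>

lemma coupling_glue:
  fixes \<mu> :: "'a::polish_space measure"
  assumes \<pi>: "\<pi> \<in> couplings \<mu> \<nu>" and \<tau>: "\<tau> \<in> couplings \<nu> \<rho>"
    and P2: "\<mu> \<in> P2" "\<nu> \<in> P2" "\<rho> \<in> P2"
    and pos: "0 < A" "0 < B" "0 < E" and cost: "cost \<pi> \<le> A\<^sup>2" "cost \<tau> \<le> B\<^sup>2"
  obtains \<gamma> where "\<gamma> \<in> couplings \<mu> \<rho>" "cost \<gamma> \<le> (A + B + E)\<^sup>2"
proof -
  obtain k :: "'a \<Rightarrow> nat" where k[measurable]: "k \<in> borel \<rightarrow>\<^sub>M count_space UNIV"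
    and k_dist: "\<And>x y. k x = k y \<Longrightarrow> dist x y \<le> E"
    using small_cells[OF pos(3)] by blast
  have s\<pi>[measurable_cong]: "sets \<pi> = sets (borel \<Otimes>\<^sub>M borel)"
    and s\<tau>[measurable_cong]: "sets \<tau> = sets (borel \<Otimes>\<^sub>M borel)"
    and [simp]: "prob_space \<pi>" "prob_space \<tau>"
    and m: "distr \<pi> borel fst = \<mu>" "distr \<pi> borel snd = \<nu>" "distr \<tau> borel fst = \<nu>" "distr \<tau> borel snd = \<rho>"
    using \<pi> \<tau> by (auto simp: couplings_iff)
  note s\<nu>[measurable_cong] = P2D(1)[OF P2(2)]
  interpret N: prob_space \<nu> by (rule P2D P2)+
  interpret P: prob_space \<pi> by simp
  interpret T: prob_space \<tau> by simp
  interpret PT: pair_prob_space \<pi> \<tau> ..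
  define w where "w n = emeasure \<nu> {y. k y = n}" for n
  have w_pos: "AE y in \<nu>. w (k y) \<noteq> 0"
  proof -
    have "AE y in \<nu>. \<forall>n. w n = 0 \<longrightarrow> k y \<noteq> n"
      unfolding AE_all_countable
    proof
      fix n
      show "AE y in \<nu>. w n = 0 \<longrightarrow> k y \<noteq> n"
      proof (cases "w n = 0")
        case True
        then have "{y. k y = n} \<in> null_sets \<nu>"
          by (auto simp: w_def null_sets_def s\<nu>)
        then show ?thesis by (auto dest: AE_not_in)
      qed simp
    qed
    then show ?thesis by auto
  qed
  \<comment> \<open>In \<open>ennreal\<close>, \<open>1 / 0\<close> is infinite, but by
    \<open>w_pos\<close> almost no point lies in a cell of mass 0.\<close>
  define r where "r n = 1 / w n" for n
  have r[measurable]: "r \<in> borel_measurable (count_space UNIV)" by simp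
  \<comment> \<open>Under the density \<open>h\<close> the two middle points are independent given
    their common cell: pairs in different cells get weight 0, the others the inverse mass of the
    cell.\<close>
  define h :: "('a \<times> 'a) \<times> ('a \<times> 'a) \<Rightarrow> ennreal" where
    "h p = (if k (snd (fst p)) = k (fst (snd p)) then r (k (snd (fst p))) else 0)" for p
  have h[measurable]: "h \<in> borel_measurable (\<pi> \<Otimes>\<^sub>M \<tau>)"
  proof -
    \<comment> \<open>Equality of cell indices becomes a countable disjunction of measurable
      events.\<close>
    have eq: "h = (\<lambda>p. if \<exists>n. k (snd (fst p)) = n \<and> k (fst (snd p)) = n then r (k (snd (fst p))) else 0)"
      by (auto simp: h_def fun_eq_iff)
    show ?thesis unfolding eq by measurable
  qed
  have cell: "(\<integral>\<^sup>+y'. (if n = k y' then r n else 0) \<partial>\<nu>) = 1" if "w n \<noteq> 0" for n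
  proof -
    have "(\<integral>\<^sup>+y'. (if n = k y' then r n else 0) \<partial>\<nu>) = (\<integral>\<^sup>+y'. r n * indicator {y. k y = n} y' \<partial>\<nu>)"
      by (intro nn_integral_cong) (auto split: split_indicator)
    also have "\<dots> = r n * w n"
      unfolding w_def by (subst nn_integral_cmult_indicator) (auto simp: s\<nu>)
    also have "\<dots> = 1"
      using that N.emeasure_finite by (simp add: r_def w_def ennreal_divide_times ennreal_divide_self less_top[symmetric])
    finally show ?thesis .
  qed
  \<comment> \<open>For fixed \<open>a\<close> the integral sees \<open>\<tau>\<close> only through
    its marginal \<open>\<nu>\<close>, where it is inverse cell mass times cell mass.\<close>
  have h1: "AE a in \<pi>. (\<integral>\<^sup>+b. h (a, b) \<partial>\<tau>) = 1"
  proof -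
    have "AE a in \<pi>. w (k (snd a)) \<noteq> 0"
      using w_pos by (subst coupling_AE(1)[OF \<pi>]) auto
    then show ?thesis
    proof eventually_elim
      case (elim a)
      have "(\<integral>\<^sup>+b. h (a, b) \<partial>\<tau>) = (\<integral>\<^sup>+y'. (if k (snd a) = k y' then r (k (snd a)) else 0) \<partial>distr \<tau> borel fst)"
        by (subst nn_integral_distr) (auto simp: h_def intro!: nn_integral_cong)
      then show ?case using cell[OF elim] by (simp add: m)
    qed
  qed
  have h2: "AE b in \<tau>. (\<integral>\<^sup>+a. h (a, b) \<partial>\<pi>) = 1"
  proof -
    have "AE b in \<tau>. w (k (fst b)) \<noteq> 0"
      using w_pos by (subst coupling_AE(2)[OF \<tau>]) auto
    then show ?thesis
    proof eventually_elim
      case (elim b)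
      have "(\<integral>\<^sup>+a. h (a, b) \<partial>\<pi>) = (\<integral>\<^sup>+y'. (if k (fst b) = k y' then r (k (fst b)) else 0) \<partial>distr \<pi> borel snd)"
        by (subst nn_integral_distr) (auto simp: h_def intro!: nn_integral_cong)
      then show ?case using cell[OF elim] by (simp add: m)
    qed
  qed
  define \<theta> where "\<theta> = density (\<pi> \<Otimes>\<^sub>M \<tau>) h"
  have s\<theta>[measurable_cong]: "sets \<theta> = sets ((borel \<Otimes>\<^sub>M borel) \<Otimes>\<^sub>M (borel \<Otimes>\<^sub>M borel))"
    unfolding \<theta>_def by (simp cong: sets_pair_measure_cong add: s\<pi> s\<tau>)
  \<comment> \<open>As \<open>h\<close> has integral 1 over \<open>\<tau>\<close> for almost every
    \<open>a\<close>, reweighting keeps the first marginal \<open>\<pi>\<close>; the second is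
    symmetric.\<close>
  have \<theta>1: "distr \<theta> (borel \<Otimes>\<^sub>M borel) fst = \<pi>"
  proof (rule measure_eqI)
    fix S assume "S \<in> sets (distr \<theta> (borel \<Otimes>\<^sub>M borel) fst)"
    then have S[measurable]: "S \<in> sets (borel \<Otimes>\<^sub>M borel)" by simp
    have "emeasure (distr \<theta> (borel \<Otimes>\<^sub>M borel) fst) S = (\<integral>\<^sup>+p. h p * indicator S (fst p) \<partial>(\<pi> \<Otimes>\<^sub>M \<tau>))"
      using S by (simp add: emeasure_distr \<theta>_def emeasure_density)
        (auto intro!: nn_integral_cong split: split_indicator)
    also have "\<dots> = (\<integral>\<^sup>+a. \<integral>\<^sup>+b. h (a, b) * indicator S a \<partial>\<tau> \<partial>\<pi>)"
      by (subst T.nn_integral_fst[symmetric]) auto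
    also have "\<dots> = (\<integral>\<^sup>+a. (\<integral>\<^sup>+b. h (a, b) \<partial>\<tau>) * indicator S a \<partial>\<pi>)"
      by (intro nn_integral_cong nn_integral_multc) measurable
    also have "\<dots> = (\<integral>\<^sup>+a. indicator S a \<partial>\<pi>)"
      using h1 by (intro nn_integral_cong_AE) auto
    finally show "emeasure (distr \<theta> (borel \<Otimes>\<^sub>M borel) fst) S = emeasure \<pi> S"
      using S by (simp add: s\<pi>)
  qed (simp add: s\<pi>)
  have \<theta>2: "distr \<theta> (borel \<Otimes>\<^sub>M borel) snd = \<tau>"
  proof (rule measure_eqI)
    fix S assume "S \<in> sets (distr \<theta> (borel \<Otimes>\<^sub>M borel) snd)"
    then have S[measurable]: "S \<in> sets (borel \<Otimes>\<^sub>M borel)" by simp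
    have "emeasure (distr \<theta> (borel \<Otimes>\<^sub>M borel) snd) S = (\<integral>\<^sup>+p. h p * indicator S (snd p) \<partial>(\<pi> \<Otimes>\<^sub>M \<tau>))"
      using S by (simp add: emeasure_distr \<theta>_def emeasure_density)
        (auto intro!: nn_integral_cong split: split_indicator)
    also have "\<dots> = (\<integral>\<^sup>+b. \<integral>\<^sup>+a. h (a, b) * indicator S b \<partial>\<pi> \<partial>\<tau>)"
      by (subst PT.nn_integral_snd[symmetric]) (auto simp: split_beta')
    also have "\<dots> = (\<integral>\<^sup>+b. (\<integral>\<^sup>+a. h (a, b) \<partial>\<pi>) * indicator S b \<partial>\<tau>)"
      by (intro nn_integral_cong nn_integral_multc) measurable
    also have "\<dots> = (\<integral>\<^sup>+b. indicator S b \<partial>\<tau>)"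
      using h2 by (intro nn_integral_cong_AE) auto
    finally show "emeasure (distr \<theta> (borel \<Otimes>\<^sub>M borel) snd) S = emeasure \<tau> S"
      using S by (simp add: s\<tau>)
  qed (simp add: s\<tau>)
  interpret Th: prob_space \<theta>
    by (rule prob_space_distrD[of fst _ "borel \<Otimes>\<^sub>M borel"]) (simp_all add: \<theta>1)
  have same_cell: "AE p in \<theta>. k (snd (fst p)) = k (fst (snd p))"
    unfolding \<theta>_def by (subst AE_density) (auto simp: h_def)
  let ?d1 = "\<lambda>p. (dist (fst (fst p)) (snd (fst p)))\<^sup>2" and ?d2 = "\<lambda>p. (dist (fst (snd p)) (snd (snd p)))\<^sup>2"
  have i1: "integrable \<theta> ?d1" "(\<integral>p. ?d1 p \<partial>\<theta>) = cost \<pi>"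
  proof -
    have "integrable (distr \<theta> (borel \<Otimes>\<^sub>M borel) fst) (\<lambda>p. (dist (fst p) (snd p))\<^sup>2)"
      unfolding \<theta>1 by (rule integrable_cost[OF \<pi> P2(1,2)])
    then show "integrable \<theta> ?d1" by (subst (asm) integrable_distr_eq) auto
    have "cost (distr \<theta> (borel \<Otimes>\<^sub>M borel) fst) = (\<integral>p. ?d1 p \<partial>\<theta>)"
      unfolding cost_def by (subst integral_distr) auto
    then show "(\<integral>p. ?d1 p \<partial>\<theta>) = cost \<pi>" by (simp add: \<theta>1)
  qed
  have i2: "integrable \<theta> ?d2" "(\<integral>p. ?d2 p \<partial>\<theta>) = cost \<tau>"
  proof -
    have "integrable (distr \<theta> (borel \<Otimes>\<^sub>M borel) snd) (\<lambda>p. (dist (fst p) (snd p))\<^sup>2)"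
      unfolding \<theta>2 by (rule integrable_cost[OF \<tau> P2(2,3)])
    then show "integrable \<theta> ?d2" by (subst (asm) integrable_distr_eq) auto
    have "cost (distr \<theta> (borel \<Otimes>\<^sub>M borel) snd) = (\<integral>p. ?d2 p \<partial>\<theta>)"
      unfolding cost_def by (subst integral_distr) auto
    then show "(\<integral>p. ?d2 p \<partial>\<theta>) = cost \<tau>" by (simp add: \<theta>2)
  qed
  define \<gamma> where "\<gamma> = distr \<theta> (borel \<Otimes>\<^sub>M borel) (\<lambda>p. (fst (fst p), snd (snd p)))"
  have "distr \<gamma> borel fst = distr (distr \<theta> (borel \<Otimes>\<^sub>M borel) fst) borel fst"
    unfolding \<gamma>_def by (subst (1 2) distr_distr) (auto simp: comp_def)
  then have g1: "distr \<gamma> borel fst = \<mu>" by (simp add: \<theta>1 m)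
  have "distr \<gamma> borel snd = distr (distr \<theta> (borel \<Otimes>\<^sub>M borel) snd) borel snd"
    unfolding \<gamma>_def by (subst (1 2) distr_distr) (auto simp: comp_def)
  then have g2: "distr \<gamma> borel snd = \<rho>" by (simp add: \<theta>2 m)
  have "prob_space \<gamma>"
    unfolding \<gamma>_def by (rule Th.prob_space_distr) measurable
  then have \<gamma>: "\<gamma> \<in> couplings \<mu> \<rho>"
    using g1 g2 by (simp add: couplings_iff) (simp add: \<gamma>_def)
  \<comment> \<open>The last summand \<open>E\<close> is \<open>E^2 / E\<close>, the contribution of
    the jump between the two middle points inside a cell.\<close>
  let ?u = "\<lambda>p. (A + B + E) * (?d1 p / A + ?d2 p / B + E)"
  have "cost \<gamma> = (\<integral>p. (dist (fst (fst p)) (snd (snd p)))\<^sup>2 \<partial>\<theta>)"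
    unfolding cost_def \<gamma>_def by (subst integral_distr) auto
  also have "\<dots> \<le> (\<integral>p. ?u p \<partial>\<theta>)"
  proof (rule integral_mono_AE)
    have "integrable \<gamma> (\<lambda>p. (dist (fst p) (snd p))\<^sup>2)"
      by (rule integrable_cost[OF \<gamma> P2(1,3)])
    then show "integrable \<theta> (\<lambda>p. (dist (fst (fst p)) (snd (snd p)))\<^sup>2)"
      unfolding \<gamma>_def by (subst (asm) integrable_distr_eq) auto
    show "integrable \<theta> ?u" using i1 i2 by auto
    show "AE p in \<theta>. (dist (fst (fst p)) (snd (snd p)))\<^sup>2 \<le> ?u p"
      using same_cell
    proof eventually_elim
      case (elim p)
      obtain x y y' z where p: "p = ((x, y), (y', z))" by (metis prod.collapse)
      have "dist x z \<le> dist x y + dist y' z + E"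
        using dist_triangle[of x z y] dist_triangle[of y z y'] k_dist[of y y'] elim by (simp add: p)
      then have "(dist x z)\<^sup>2 \<le> (dist x y + dist y' z + E)\<^sup>2"
        by (intro power_mono) auto
      also have "\<dots> \<le> (A + B + E) * ((dist x y)\<^sup>2 / A + (dist y' z)\<^sup>2 / B + E\<^sup>2 / E)"
        by (rule weighted_square_le3) (fact pos)+
      finally show ?case using pos by (simp add: p power2_eq_square)
    qed
  qed
  also have "\<dots> = (A + B + E) * (cost \<pi> / A + cost \<tau> / B + E)"
    using i1 i2 by (simp add: Th.prob_space)
  also have "\<dots> \<le> (A + B + E) * (A + B + E)"
    using pos cost by (intro mult_left_mono add_mono) (auto simp: divide_le_eq power2_eq_square)
  finally show thesis using that \<gamma> by (simp add: power2_eq_square)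
qed

lemma W2_triangle:
  fixes \<mu> :: "'a::polish_space measure"
  assumes P2: "\<mu> \<in> P2" "\<nu> \<in> P2" "\<rho> \<in> P2"
  shows "W2 \<mu> \<rho> \<le> W2 \<mu> \<nu> + W2 \<nu> \<rho>"
proof (rule field_le_epsilon)
  fix e :: real assume e: "0 < e"
  \<comment> \<open>The thirds of \<open>e\<close> are the slack of the two couplings and the cell
    diameter; they also make \<open>A\<close> and \<open>B\<close> positive when a distance is
    0.\<close>
  define A B where "A = W2 \<mu> \<nu> + e / 3" and "B = W2 \<nu> \<rho> + e / 3"
  have pos: "0 < A" "0 < B" "0 < e / 3"
    using e W2_nonneg[of \<mu> \<nu>] W2_nonneg[of \<nu> \<rho>] by (auto simp: A_def B_def intro: add_nonneg_pos)
  have "W2 \<mu> \<nu> < A" "W2 \<nu> \<rho> < B" using e by (simp_all add: A_def B_def)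
  then obtain \<pi> \<tau> where \<pi>: "\<pi> \<in> couplings \<mu> \<nu>" "cost \<pi> < A\<^sup>2"
    and \<tau>: "\<tau> \<in> couplings \<nu> \<rho>" "cost \<tau> < B\<^sup>2"
    using W2_less_couplingE P2 by metis
  obtain \<gamma> where "\<gamma> \<in> couplings \<mu> \<rho>" "cost \<gamma> \<le> (A + B + e / 3)\<^sup>2"
    using coupling_glue[OF \<pi>(1) \<tau>(1) P2 pos] \<pi>(2) \<tau>(2) by (metis less_imp_le)
  then have "(W2 \<mu> \<rho>)\<^sup>2 \<le> (A + B + e / 3)\<^sup>2"
    using W2_sq_le_cost[OF _ P2(1,3)] by fastforce
  moreover have "0 \<le> A + B + e / 3" using pos by simp
  ultimately have "W2 \<mu> \<rho> \<le> A + B + e / 3" by (rule power2_le_imp_le)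
  then show "W2 \<mu> \<rho> \<le> W2 \<mu> \<nu> + W2 \<nu> \<rho> + e" by (simp add: A_def B_def)
qed

section \<open>Definiteness of the Wasserstein distance\<close>

lemma W2_refl:
  fixes \<mu> :: "'a::polish_space measure"
  assumes P2: "\<mu> \<in> P2"
  shows "W2 \<mu> \<mu> = 0"
proof -
  note [measurable_cong] = P2D(1)[OF P2]
  interpret prob_space \<mu> by (rule P2D P2)+
  let ?\<pi> = "distr \<mu> (borel \<Otimes>\<^sub>M borel) (\<lambda>x. (x, x))"
  have "prob_space ?\<pi>" by (rule prob_space_distr) measurable
  then have "?\<pi> \<in> couplings \<mu> \<mu>"
    using distr_id2[OF P2D(1)[OF P2, symmetric]]
    by (simp add: couplings_iff distr_distr comp_def)
  then have "(W2 \<mu> \<mu>)\<^sup>2 \<le> cost ?\<pi>" using P2 by (intro W2_sq_le_cost)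
  also have "cost ?\<pi> = 0"
    unfolding cost_def by (subst integral_distr) simp_all
  finally show ?thesis by simp
qed

text \<open>When transport is arbitrarily cheap, the mass of \<open>F\<close> ends up in each
  neighbourhood \<open>G n\<close> up to a small error; as \<open>F\<close> is closed, these
  neighbourhoods shrink to \<open>F\<close>.\<close>

lemma W2_zero_closed_le:
  fixes \<mu> :: "'a::polish_space measure"
  assumes P2: "\<mu> \<in> P2" "\<nu> \<in> P2" and W: "W2 \<mu> \<nu> = 0" and F: "closed F" "F \<noteq> {}"
  shows "measure \<mu> F \<le> measure \<nu> F"
proof -
  interpret M: prob_space \<mu> by (rule P2D P2)+
  interpret N: prob_space \<nu> by (rule P2D P2)+
  define G where "G n = {y. infdist y F \<le> inverse (real (Suc n))}" for n
  have G: "closed (G n)" for n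
    unfolding G_def by (intro closed_Collect_le continuous_intros)
  have bound: "measure \<mu> F \<le> measure \<nu> (G n) + inverse (real (Suc n))" for n
  proof -
    define e where "e = inverse (real (Suc n))"
    have e: "0 < e" by (simp add: e_def)
    have Ge: "G n = {y. infdist y F \<le> e}" by (simp add: G_def e_def)
    \<comment> \<open>With cost below \<open>e^3\<close>, Markov's inequality at distance
      \<open>e\<close> bounds the mass of \<open>S\<close> by \<open>e^3 / e^2 = e\<close>.\<close>
    obtain \<pi> where \<pi>: "\<pi> \<in> couplings \<mu> \<nu>" "cost \<pi> < (sqrt (e ^ 3))\<^sup>2"
      using W2_less_couplingE[OF P2, of "sqrt (e ^ 3)"] W e by auto
    have s\<pi>[measurable_cong]: "sets \<pi> = sets (borel \<Otimes>\<^sub>M borel)" and "prob_space \<pi>"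
      and \<mu>: "\<mu> = distr \<pi> borel fst" and \<nu>: "\<nu> = distr \<pi> borel snd"
      using \<pi> by (auto simp: couplings_iff)
    have sp: "space \<pi> = UNIV" using sets_eq_imp_space_eq[OF s\<pi>] by (simp add: space_pair_measure)
    interpret prob_space \<pi> by fact
    have [measurable]: "F \<in> sets borel" "G n \<in> sets borel" using F G by auto
    define S where "S = {p \<in> space \<pi>. e \<le> dist (fst p) (snd p)}"
    have [measurable]: "S \<in> sets \<pi>" unfolding S_def by measurable
    have "measure \<mu> F = measure \<pi> (fst -` F)"
      unfolding \<mu> by (subst measure_distr) (auto simp: sp)
    also have "\<dots> \<le> measure \<pi> (snd -` G n \<union> S)"
    proof (rule finite_measure_mono)
      show "fst -` F \<subseteq> snd -` G n \<union> S"
      proof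
        fix p :: "'a \<times> 'a" assume p: "p \<in> fst -` F"
        then have "infdist (snd p) F \<le> dist (snd p) (fst p)" by (intro infdist_le) auto
        then show "p \<in> snd -` G n \<union> S"
          by (cases "p \<in> S") (auto simp: S_def sp Ge dist_commute)
      qed
      have "snd -` G n \<inter> space \<pi> \<in> sets \<pi>" by measurable
      then show "snd -` G n \<union> S \<in> sets \<pi>" by (auto simp: sp)
    qed
    also have "\<dots> \<le> measure \<pi> (snd -` G n) + measure \<pi> S"
    proof (rule measure_Un_le)
      have "snd -` G n \<inter> space \<pi> \<in> sets \<pi>" by measurable
      then show "snd -` G n \<in> sets \<pi>" by (auto simp: sp)
    qed measurable
    also have "measure \<pi> (snd -` G n) = measure \<nu> (G n)"
      unfolding \<nu> by (subst measure_distr) (auto simp: sp)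
    also have "measure \<pi> S \<le> e"
    proof -
      have "e\<^sup>2 * measure \<pi> S = (\<integral>p. e\<^sup>2 * indicator S p \<partial>\<pi>)" by simp
      also have "\<dots> \<le> cost \<pi>"
        unfolding cost_def
      proof (rule integral_mono)
        show "integrable \<pi> (\<lambda>p. (dist (fst p) (snd p))\<^sup>2)" by (rule integrable_cost[OF \<pi>(1) P2])
        show "e\<^sup>2 * indicator S p \<le> (dist (fst p) (snd p))\<^sup>2" for p
          using e by (auto simp: S_def split: split_indicator intro!: power_mono)
      qed (simp add: emeasure_eq_measure)
      also have "\<dots> \<le> e\<^sup>2 * e" using \<pi>(2) e by (simp add: power3_eq_cube power2_eq_square)
      finally show ?thesis using e by simp
    qed
    finally show ?thesis by (simp add: e_def)
  qed
  have "(\<lambda>n. measure \<nu> (G n)) \<longlonglongrightarrow> measure \<nu> (\<Inter>n. G n)"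
  proof (rule N.finite_Lim_measure_decseq)
    show "range G \<subseteq> sets \<nu>" using G by (auto simp: P2D[OF P2(2)])
    show "decseq G"
    proof (rule decseq_SucI)
      fix n
      have "inverse (real (Suc (Suc n))) \<le> inverse (real (Suc n))" by (intro le_imp_inverse_le) auto
      then show "G (Suc n) \<subseteq> G n" by (auto simp: G_def simp del: of_nat_Suc intro: order_trans)
    qed
  qed
  moreover have "(\<Inter>n. G n) = F"
  proof -
    have "y \<in> (\<Inter>n. G n) \<longleftrightarrow> y \<in> F" for y
    proof
      assume "y \<in> (\<Inter>n. G n)"
      then have "infdist y F \<le> inverse (real (Suc n))" for n unfolding G_def by blast
      then have "infdist y F \<le> 0"
        by (intro LIMSEQ_le_const[OF LIMSEQ_inverse_real_of_nat]) blast
      then show "y \<in> F"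
        using infdist_nonneg[of y F] by (simp add: in_closed_iff_infdist_zero[OF F])
    next
      assume "y \<in> F"
      then show "y \<in> (\<Inter>n. G n)" by (simp add: G_def)
    qed
    then show ?thesis by blast
  qed
  ultimately have "(\<lambda>n. measure \<nu> (G n) + inverse (real (Suc n))) \<longlonglongrightarrow> measure \<nu> F + 0"
    by (intro tendsto_add LIMSEQ_inverse_real_of_nat) auto
  then show ?thesis
    using bound by (intro LIMSEQ_le_const) auto
qed

text \<open>Measures at distance 0 agree on closed sets, which form an intersection-stable generator
  of the Borel sets.\<close>

lemma W2_eq_0_iff:
  fixes \<mu> :: "'a::polish_space measure"
  assumes P2: "\<mu> \<in> P2" "\<nu> \<in> P2"
  shows "W2 \<mu> \<nu> = 0 \<longleftrightarrow> \<mu> = \<nu>"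
proof
  assume W: "W2 \<mu> \<nu> = 0"
  interpret M: prob_space \<mu> by (rule P2D P2)+
  interpret N: prob_space \<nu> by (rule P2D P2)+
  \<comment> \<open>The empty set is treated apart, since \<open>infdist\<close> to it is 0 by
    convention.\<close>
  have "measure \<mu> F = measure \<nu> F" if "closed F" for F
    using W2_zero_closed_le[OF P2 W that] W2_zero_closed_le[OF P2(2,1) _ that] W
    by (cases "F = {}") (auto simp: W2_commute[of \<mu>] intro: antisym)
  then have eq: "emeasure \<mu> F = emeasure \<nu> F" if "closed F" for F
    using that by (simp add: M.emeasure_eq_measure N.emeasure_eq_measure)
  have "sets \<mu> = sigma_sets UNIV (Collect closed)" "sets \<nu> = sigma_sets UNIV (Collect closed)"
    using P2D(1)[OF P2(1)] P2D(1)[OF P2(2)] by (simp_all add: borel_eq_closed)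
  then show "\<mu> = \<nu>"
    using eq M.emeasure_finite
    by (intro measure_eqI_generator_eq[where E = "Collect closed" and \<Omega> = UNIV and A = "\<lambda>_. UNIV"])
      (auto simp: Int_stable_def)
qed (use W2_refl P2 in auto)

lemma Metric_space_W2: "Metric_space (P2 :: 'a::polish_space measure set) W2"
  by unfold_locales (auto simp: W2_nonneg W2_eq_0_iff W2_triangle intro: W2_commute)

section \<open>Dilations of the Wasserstein space\<close>

text \<open>If \<open>W2\<close> is additive along \<open>\<mu>\<close>, a Dirac measure at \<open>x\<close> and \<open>\<nu>\<close>, then every coupling of \<open>\<mu>\<close> and
  \<open>\<nu>\<close> is optimal, in particular the product measure.\<close>

lemma W2_additive_through_return:
  fixes \<mu> \<nu> :: "'a::polish_space measure"
  assumes P2: "\<mu> \<in> P2" "\<nu> \<in> P2" and W: "W2 \<mu> \<nu> = A + B"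
    and A: "W2 \<mu> (return borel x) = A" "0 < A" and B: "W2 (return borel x) \<nu> = B" "0 < B"
  shows "AE u in \<mu>. dist u x = A \<and> (AE v in \<nu>. dist x v = B \<and> dist u v = A + B)"
proof -
  note [measurable_cong] = P2D(1)[OF P2(1)] P2D(1)[OF P2(2)]
  interpret M: prob_space \<mu> by (rule P2D P2)+
  interpret N: prob_space \<nu> by (rule P2D P2)+
  interpret pair_prob_space \<mu> \<nu> ..
  let ?\<pi> = "\<mu> \<Otimes>\<^sub>M \<nu>"
  note \<pi> = pair_measure_coupling[OF P2]
  have A2: "(\<integral>u. (dist x u)\<^sup>2 \<partial>\<mu>) = A\<^sup>2"
    using A W2_return_sq[OF P2(1), of x] by (simp add: W2_commute[of "return borel x"])
  have B2: "(\<integral>v. (dist x v)\<^sup>2 \<partial>\<nu>) = B\<^sup>2"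
    using B W2_return_sq[OF P2(2), of x] by simp
  have i: "integrable ?\<pi> (\<lambda>p. (dist x (fst p))\<^sup>2)" "integrable ?\<pi> (\<lambda>p. (dist x (snd p))\<^sup>2)"
    "(\<integral>p. (dist x (fst p))\<^sup>2 \<partial>?\<pi>) = A\<^sup>2" "(\<integral>p. (dist x (snd p))\<^sup>2 \<partial>?\<pi>) = B\<^sup>2"
    using P2D(4)[OF P2(1), of x] P2D(4)[OF P2(2), of x] A2 B2
    by (simp_all add: coupling_integral[OF \<pi>, where f = "\<lambda>y. (dist x y)\<^sup>2"])
  note j = integrable_cost[OF \<pi> P2]
  \<comment> \<open>The integral of \<open>h\<close> is \<open>(A + B)^2 - cost ?\<pi>\<close>,
    which is nonpositive because \<open>W2 \<mu> \<nu> = A + B\<close> bounds the cost from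
    below.\<close>
  define h where "h p = (A + B) * ((dist x (fst p))\<^sup>2 / A + (dist x (snd p))\<^sup>2 / B) - (dist (fst p) (snd p))\<^sup>2" for p
  have ih: "integrable ?\<pi> h"
    unfolding h_def using i j by auto
  have tri: "(dist (fst p) (snd p))\<^sup>2 \<le> (dist x (fst p) + dist x (snd p))\<^sup>2" for p
    by (intro power_mono dist_triangle3) auto
  \<comment> \<open>\<open>h\<close> splits into the defects of the triangle inequality and of
    Cauchy-Schwarz, both nonnegative, so both vanish almost everywhere.\<close>
  have heq: "h p = (dist x (fst p) + dist x (snd p))\<^sup>2 - (dist (fst p) (snd p))\<^sup>2 +
      (B * dist x (fst p) - A * dist x (snd p))\<^sup>2 / (A * B)" for p
    using weighted_square_le[OF A(2) B(2), of "dist x (fst p)" "dist x (snd p)"] by (simp add: h_def)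
  have q: "0 \<le> (B * dist x (fst p) - A * dist x (snd p))\<^sup>2 / (A * B)" for p
    using A B by simp
  have h0: "0 \<le> h p" for p
    using tri[of p] q[of p] by (simp add: heq)
  have "(\<integral>p. h p \<partial>?\<pi>) = (A + B) * (A\<^sup>2 / A + B\<^sup>2 / B) - cost ?\<pi>"
    unfolding h_def using i j by (simp add: cost_def)
  also have "\<dots> = (A + B)\<^sup>2 - cost ?\<pi>"
    using A B by (simp add: power2_eq_square)
  also have "\<dots> \<le> 0"
    using W2_sq_le_cost[OF \<pi> P2] W by simp
  finally have "(\<integral>p. h p \<partial>?\<pi>) = 0"
    using h0 by (intro antisym) simp_all
  then have "AE p in ?\<pi>. h p = 0"
    using integral_nonneg_eq_0_iff_AE[OF ih] h0 by simp
  then have "AE p in ?\<pi>. dist (fst p) (snd p) = dist x (fst p) + dist x (snd p) \<and>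
      B * dist x (fst p) = A * dist x (snd p)"
  proof eventually_elim
    case (elim p)
    then have "(dist (fst p) (snd p))\<^sup>2 = (dist x (fst p) + dist x (snd p))\<^sup>2"
      and 0: "(B * dist x (fst p) - A * dist x (snd p))\<^sup>2 / (A * B) = 0"
      using tri[of p] q[of p] heq[of p] by linarith+
    then have "dist (fst p) (snd p) = dist x (fst p) + dist x (snd p)"
      by (subst (asm) power2_eq_iff_nonneg) auto
    moreover have "B * dist x (fst p) = A * dist x (snd p)"
      using 0 A B by simp
    ultimately show ?case by blast
  qed
  from AE_pair[OF this]
  have "AE u in \<mu>. AE v in \<nu>. dist u v = dist x u + dist x v \<and> B * dist x u = A * dist x v"
    by simp
  then show ?thesis
  proof eventually_elim
    case (elim u)
    \<comment> \<open>For fixed \<open>u\<close>, proportionality makes \<open>dist x v\<close>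
      constant in \<open>v\<close>; the second moment \<open>B^2\<close> of \<open>\<nu>\<close>
      fixes the constant, whence \<open>dist x u = A\<close>.\<close>
    have "AE v in \<nu>. dist x v = B * dist x u / A"
      using elim
    proof eventually_elim
      case (elim v)
      then show ?case using A(2) by (simp add: eq_divide_eq mult.commute)
    qed
    then have "(\<integral>v. (dist x v)\<^sup>2 \<partial>\<nu>) = (\<integral>v. (B * dist x u / A)\<^sup>2 \<partial>\<nu>)"
      by (intro integral_cong_AE) (auto elim!: eventually_mono)
    then have "B\<^sup>2 = (B * dist x u / A)\<^sup>2"
      by (simp add: B2 N.prob_space)
    then have "B = B * dist x u / A"
      using A B by (subst (asm) power2_eq_iff_nonneg) auto
    then have u: "dist x u = A" using A B by (simp add: field_simps)
    have "AE v in \<nu>. dist x v = B \<and> dist u v = A + B"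
      using elim
    proof eventually_elim
      case (elim v)
      then have "dist x v = B" using A B by (simp add: u)
      then show ?case using elim u by simp
    qed
    then show ?case using u by (simp add: dist_commute)
  qed
qed

lemma AE_return_eq: "AE y in return borel x. y = (x :: 'a::polish_space)"
  by (subst AE_return) auto

lemma return_eq_iff: "return borel x = return borel y \<longleftrightarrow> x = (y :: 'a::polish_space)"
  using W2_return_return[of x y] W2_eq_0_iff[OF return_P2 return_P2, of x y] by auto

text \<open>Dirac measures embed the base isometrically, which settles one direction. For the other,
  rigidity provides one \<open>u\<close> whose segment to \<open>x\<close> is extended by almost all
  points of \<open>\<nu>\<close> and of \<open>\<rho>\<close>; non-branching makes these a single
  point.\<close>

lemma non_branching_P2_return_iff:
  fixes x :: "'a::polish_space"
  shows "non_branching_at P2 W2 (return borel x) \<longleftrightarrow> non_branching_at UNIV dist x"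
proof
  assume nb: "non_branching_at P2 W2 (return borel x)"
  show "non_branching_at UNIV dist x"
    unfolding non_branching_at_def
  proof (intro ballI impI)
    fix u v w assume "u \<noteq> x" "dist u v = dist u x + dist x v \<and> dist u x + dist x v = dist u x + dist x w \<and>
      dist u x + dist x w = dist u w"
    then show "v = w"
      using nb[unfolded non_branching_at_def, rule_format, of "return borel u" "return borel v" "return borel w"]
      by (simp add: return_P2 W2_return_return return_eq_iff)
  qed
next
  assume nb: "non_branching_at UNIV dist x"
  show "non_branching_at P2 W2 (return borel x)"
    unfolding non_branching_at_def
  proof (intro ballI impI)
    let ?x = "return borel x"
    fix \<mu> \<nu> \<rho> :: "'a measure" assume P2: "\<mu> \<in> P2" "\<nu> \<in> P2" "\<rho> \<in> P2" and ne: "\<mu> \<noteq> ?x"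
      and eq: "W2 \<mu> \<nu> = W2 \<mu> ?x + W2 ?x \<nu> \<and> W2 \<mu> ?x + W2 ?x \<nu> = W2 \<mu> ?x + W2 ?x \<rho> \<and>
        W2 \<mu> ?x + W2 ?x \<rho> = W2 \<mu> \<rho>"
    define A B where "A = W2 \<mu> ?x" and "B = W2 ?x \<nu>"
    have W: "W2 \<mu> \<nu> = A + B" "W2 \<mu> \<rho> = A + B" "W2 ?x \<rho> = B"
      using eq by (auto simp: A_def B_def)
    have "0 < A"
      using ne W2_nonneg[of \<mu> ?x] W2_eq_0_iff[OF P2(1) return_P2, of x] by (simp add: A_def)
    \<comment> \<open>Rigidity requires \<open>0 < B\<close>; for \<open>B = 0\<close> both measures
      equal \<open>?x\<close>.\<close>
    show "\<nu> = \<rho>"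
    proof (cases "B = 0")
      case True
      then show ?thesis
        using W2_eq_0_iff[OF return_P2 P2(2), of x] W2_eq_0_iff[OF return_P2 P2(3), of x] W
        by (simp add: B_def)
    next
      case False
      then have "0 < B" using W2_nonneg[of ?x \<nu>] by (simp add: B_def)
      interpret M: prob_space \<mu> by (rule P2D P2)+
      interpret N: prob_space \<nu> by (rule P2D P2)+
      interpret R: prob_space \<rho> by (rule P2D P2)+
      have AE: "AE u in \<mu>. dist u x = A \<and> (AE v in \<nu>. dist x v = B \<and> dist u v = A + B) \<and>
          (AE w in \<rho>. dist x w = B \<and> dist u w = A + B)"
        using W2_additive_through_return[OF P2(1,2) W(1) A_def[symmetric] \<open>0 < A\<close> B_def[symmetric] \<open>0 < B\<close>]
          W2_additive_through_return[OF P2(1,3) W(2) A_def[symmetric] \<open>0 < A\<close> W(3) \<open>0 < B\<close>]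
        by eventually_elim simp
      obtain u where u: "dist u x = A" "AE v in \<nu>. dist x v = B \<and> dist u v = A + B"
          "AE w in \<rho>. dist x w = B \<and> dist u w = A + B"
        using eventually_happens'[OF M.ae_filter_bot AE] by blast
      have "u \<noteq> x" using u(1) \<open>0 < A\<close> by auto
      have unique: "v = w" if "dist x v = B \<and> dist u v = A + B" "dist x w = B \<and> dist u w = A + B" for v w
        using nb[unfolded non_branching_at_def, rule_format, OF UNIV_I UNIV_I UNIV_I \<open>u \<noteq> x\<close>, of v w] that u(1)
        by simp
      obtain w where w: "dist x w = B \<and> dist u w = A + B"
        using eventually_happens'[OF R.ae_filter_bot u(3)] by blast
      have "\<nu> = return borel w"
        by (rule eq_return[OF P2(2) eventually_mono[OF u(2)]]) (rule unique[OF _ w])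
      moreover have "\<rho> = return borel w"
        by (rule eq_return[OF P2(3) eventually_mono[OF u(3)]]) (rule unique[OF _ w])
      ultimately show ?thesis by simp
    qed
  qed
qed

section \<open>Restriction of dilations of the Wasserstein space to Dirac measures\<close>

locale dilated_P2 = dilated_space P2 W2 \<mu> D
  for \<mu> :: "'a::polish_space measure" and D
begin

lemma AE_dist_vertex: "AE u in \<mu>. dist u x = W2 \<mu> (return borel x)"
proof -
  let ?x = "return borel x" and ?r = "W2 \<mu> (return borel x)"
  interpret M: prob_space \<mu> by (rule P2D vertex_in)+
  show ?thesis
  proof (cases "?r = 0")
    case True
    then have \<mu>: "\<mu> = return borel x" using W2_eq_0_iff[OF vertex_in return_P2] by simp
    have "AE u in \<mu>. u = x" unfolding \<mu> by (rule AE_return_eq)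
    then show ?thesis by eventually_elim (simp add: True)
  next
    case False
    then have r: "0 < ?r" by (simp add: less_le)
    \<comment> \<open>Doubling \<open>?x\<close> from the vertex makes \<open>?x\<close> a midpoint
      of \<open>\<mu>\<close> and \<open>D 2 ?x\<close>, so rigidity applies to
      \<open>\<mu>\<close>.\<close>
    have "W2 \<mu> (D 2 ?x) = ?r + ?r" "W2 ?x (D 2 ?x) = ?r"
      using dist_vertex_D[of 2 ?x] dist_D[of 2 ?x] by (simp_all add: return_P2)
    from W2_additive_through_return[OF vertex_in _ this(1) refl r this(2) r]
    show ?thesis by (auto simp: return_P2 elim: eventually_mono)
  qed
qed

text \<open>Almost all points have the same distances to every member of a countable dense set, and
  these distances determine a point.\<close>

lemma vertex_return: "\<exists>z. \<mu> = return borel z"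
proof -
  interpret M: prob_space \<mu> by (rule P2D vertex_in)+
  obtain Q :: "'a set" where Q: "countable Q" "\<And>X. open X \<Longrightarrow> X \<noteq> {} \<Longrightarrow> \<exists>d \<in> Q. d \<in> X"
    by (rule countable_dense_setE) blast
  have AE: "AE u in \<mu>. \<forall>x\<in>Q. dist u x = W2 \<mu> (return borel x)"
    using AE_dist_vertex by (simp add: AE_ball_countable[OF Q(1)])
  obtain z where z: "\<forall>x\<in>Q. dist z x = W2 \<mu> (return borel x)"
    using eventually_happens'[OF M.ae_filter_bot AE] by blast
  have "u = z" if u: "\<forall>x\<in>Q. dist u x = W2 \<mu> (return borel x)" for u
  proof (rule ccontr)
    assume "u \<noteq> z"
    then obtain x where "x \<in> Q" "x \<in> ball z (dist u z / 2)"
      using Q(2)[of "ball z (dist u z / 2)"] by auto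
    then have "dist z x < dist u z / 2" "dist u x = dist z x" using u z by auto
    then show False using dist_triangle2[of u z x] by simp
  qed
  then have "AE u in \<mu>. u = z" using AE by (auto elim!: eventually_mono)
  then show ?thesis using eq_return[OF vertex_in] by blast
qed

lemma D_eq_return:
  assumes \<mu>: "\<mu> = return borel z" and "0 \<le> t" "dist z y = t * dist z x" "dist y x = (1 - t) * dist z x"
  shows "D t (return borel x) = return borel y"
  using assms by (intro D_unique[symmetric]) (auto simp: return_P2 W2_return_return)

text \<open>For \<open>0 < t < 1\<close> almost every point of \<open>D t ?x\<close> divides the
  distance from \<open>z\<close> to \<open>x\<close> in the ratio \<open>t : 1 - t\<close>; for
  \<open>1 < t\<close> almost every one extends the segment beyond \<open>x\<close>. Uniqueness of
  geodesics from the vertex then identifies \<open>D t ?x\<close> with the Dirac measure at one such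
  point.\<close>

lemma D_return:
  assumes \<mu>: "\<mu> = return borel z" and t: "0 \<le> t"
  shows "\<exists>y. D t (return borel x) = return borel y"
proof -
  let ?x = "return borel x" and ?r = "dist z x"
  have Wr: "W2 \<mu> ?x = ?r" by (simp add: \<mu> W2_return_return)
  have \<nu>: "D t ?x \<in> P2" using t by (simp add: return_P2)
  note [measurable_cong] = P2D(1)[OF \<nu>]
  interpret N: prob_space "D t ?x" by (rule P2D \<nu>)+
  interpret M: prob_space \<mu> by (rule P2D vertex_in)+
  have d1: "W2 \<mu> (D t ?x) = t * ?r" and d2: "W2 ?x (D t ?x) = \<bar>1 - t\<bar> * ?r"
    using dist_vertex_D[OF t, of ?x] dist_D[OF t, of ?x] by (simp_all add: return_P2 Wr)
  consider "t = 0" | "t = 1" | "?r = 0" | "0 < t" "t < 1" "?r \<noteq> 0" | "1 < t" "?r \<noteq> 0"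
    using t by linarith
  then show ?thesis
  proof cases
    case 1
    then show ?thesis by (auto simp: D_0 return_P2 \<mu>)
  next
    case 2
    then show ?thesis by (auto simp: return_P2)
  next
    case 3
    then show ?thesis
      using d1 W2_eq_0_iff[OF vertex_in \<nu>] by (auto simp: \<mu>)
  next
    case 4
    \<comment> \<open>\<open>h\<close> has integral 0 by \<open>d1\<close> and \<open>d2\<close>,
      and \<open>heq\<close> writes it as a sum of two nonnegative terms, so a typical
      \<open>y\<close> makes both vanish.\<close>
    define h where "h y = (1 - t) * (dist z y)\<^sup>2 + t * (dist x y)\<^sup>2 - t * (1 - t) * ?r\<^sup>2" for y
    have i: "integrable (D t ?x) h"
      unfolding h_def using P2D(4)[OF \<nu>] by auto
    have "(\<integral>y. h y \<partial>D t ?x) = (1 - t) * (W2 \<mu> (D t ?x))\<^sup>2 + t * (W2 ?x (D t ?x))\<^sup>2 - t * (1 - t) * ?r\<^sup>2"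
      unfolding h_def using P2D(4)[OF \<nu>]
      by (simp add: \<mu> W2_return_sq[OF \<nu>, symmetric] N.prob_space)
    also have "\<dots> = 0"
      unfolding d1 d2 power_mult_distrib power2_abs by (simp add: power2_eq_square algebra_simps)
    finally have int0: "(\<integral>y. h y \<partial>D t ?x) = 0" .
    have tri: "?r\<^sup>2 \<le> (dist z y + dist x y)\<^sup>2" for y
      by (intro power_mono dist_triangle2) auto
    have heq: "h y = ((1 - t) * dist z y - t * dist x y)\<^sup>2 + t * (1 - t) * ((dist z y + dist x y)\<^sup>2 - ?r\<^sup>2)" for y
      unfolding h_def by (simp add: power2_eq_square algebra_simps)
    have q: "0 \<le> t * (1 - t) * ((dist z y + dist x y)\<^sup>2 - ?r\<^sup>2)" for y
      using 4 tri[of y] by simp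
    have AE: "AE y in D t ?x. h y = 0"
      using integral_nonneg_eq_0_iff_AE[OF i] int0 q by (simp add: heq)
    obtain y where y: "h y = 0"
      using eventually_happens'[OF N.ae_filter_bot AE] by blast
    then have "((1 - t) * dist z y - t * dist x y)\<^sup>2 = 0" "t * (1 - t) * ((dist z y + dist x y)\<^sup>2 - ?r\<^sup>2) = 0"
      using q[of y] by (simp_all add: heq add_nonneg_eq_0_iff)
    then have 1: "(1 - t) * dist z y = t * dist x y" and "(dist z y + dist x y)\<^sup>2 = ?r\<^sup>2"
      using 4 by simp_all
    then have 2: "dist z y + dist x y = ?r"
      by (subst (asm) power2_eq_iff_nonneg) auto
    have "dist z y = t * ?r"
      using 1 by (simp add: 2[symmetric] algebra_simps)
    moreover from this 2 have "dist y x = (1 - t) * ?r"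
      by (simp add: dist_commute algebra_simps)
    ultimately show ?thesis using D_eq_return[OF \<mu> t] by blast
  next
    case 5
    have pos: "0 < ?r" "0 < (t - 1) * ?r" using 5 by (auto intro!: mult_pos_pos)
    have "W2 \<mu> (D t ?x) = ?r + (t - 1) * ?r" using d1 by (simp add: algebra_simps)
    moreover have "W2 ?x (D t ?x) = (t - 1) * ?r" using d2 5 by simp
    ultimately have "AE u in \<mu>. dist u x = ?r \<and>
        (AE v in D t ?x. dist x v = (t - 1) * ?r \<and> dist u v = ?r + (t - 1) * ?r)"
      using W2_additive_through_return[OF vertex_in \<nu> _ Wr pos(1) _ pos(2)] by blast
    moreover have "AE u in \<mu>. u = z" unfolding \<mu> by (rule AE_return_eq)
    ultimately have "AE u in \<mu>. AE v in D t ?x. dist x v = (t - 1) * ?r \<and> dist z v = t * ?r"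
      by eventually_elim (simp add: algebra_simps)
    \<comment> \<open>The inner statement is free of \<open>u\<close>, so almost everywhere in a
      probability space means outright.\<close>
    then have AE: "AE v in D t ?x. dist x v = (t - 1) * ?r \<and> dist z v = t * ?r"
      by simp
    obtain v where v: "dist x v = (t - 1) * ?r" "dist z v = t * ?r"
      using eventually_happens'[OF N.ae_filter_bot AE] by blast
    \<comment> \<open>Here \<open>x\<close> lies at fraction \<open>1 / t\<close> of the way from
      \<open>z\<close> to \<open>v\<close>, so \<open>D (1 / t)\<close> carries the Dirac measure at
      \<open>v\<close> to \<open>?x\<close>, and \<open>D t\<close> inverts this.\<close>
    have "(1 - 1 / t) * (t * ?r) = (t - 1) * ?r" using 5 by (simp add: field_simps)
    then have "D (1 / t) (return borel v) = ?x"
      using 5 by (intro D_eq_return[OF \<mu>]) (simp_all only: v, simp_all)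
    then have "D t ?x = D t (D (1 / t) (return borel v))" by simp
    also have "\<dots> = return borel v" using 5 by (simp add: D_D return_P2)
    finally show ?thesis by blast
  qed
qed

text \<open>\<open>D\<close> preserves the isometrically embedded Dirac measures, so its dilation
  formula restricts to points.\<close>

lemma dilated_base:
  obtains z D' where "\<mu> = return borel z" "dilated_space UNIV dist z D'"
proof -
  obtain z where \<mu>: "\<mu> = return borel z" using vertex_return by blast
  obtain D' where D': "\<And>t x. 0 \<le> t \<Longrightarrow> D t (return borel x) = return borel (D' t x)"
    using D_return[OF \<mu>] by metis
  have dist: "dist x y = W2 (return borel x) (return borel y)" for x y :: 'a
    by (simp add: W2_return_return)
  have "D' 1 x = x" for x
    using D'[of 1 x] by (simp add: return_P2 return_eq_iff)
  moreover have "(dist (D' l x) (D' k y))\<^sup>2 =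
      l * (l - k) * (dist z x)\<^sup>2 + k * (k - l) * (dist z y)\<^sup>2 + l * k * (dist x y)\<^sup>2"
    if "0 \<le> l" "0 \<le> k" for l k x y
    using that D_dist_sq[of l k "return borel x" "return borel y"]
    by (simp add: dist D'[symmetric] \<mu>[symmetric] return_P2)
  ultimately have "dilated_space UNIV dist z D'"
    by unfold_locales (auto simp: cone_dilation_def)
  then show thesis using that \<mu> by blast
qed

end

lemma is_cone_vertex_P2E:
  assumes "is_cone_vertex (P2 :: 'a::polish_space measure set) W2 \<mu>"
  obtains z where "\<mu> = return borel z" "is_cone_vertex (UNIV :: 'a set) dist z"
proof -
  obtain D w where "dilated_space P2 W2 \<mu> D" and w: "w \<in> P2" "w \<noteq> \<mu>"
    using is_cone_vertexE[OF Metric_space_W2 assms] by blast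
  then interpret dilated_space P2 W2 \<mu> D by simp
  interpret dilated_P2 \<mu> D ..
  obtain z D' where z: "\<mu> = return borel z" "dilated_space UNIV dist z D'"
    by (rule dilated_base)
  interpret B: dilated_space UNIV dist z D' by (rule z)
  \<comment> \<open>Over a one-point space the only element of \<open>P2\<close> is the Dirac
    measure, contradicting \<open>w \<noteq> \<mu>\<close>.\<close>
  have "\<exists>x. x \<noteq> z"
  proof (rule ccontr)
    assume "\<not> (\<exists>x. x \<noteq> z)"
    then have "w = return borel z" using w by (intro eq_return) auto
    then show False using w z by simp
  qed
  then show thesis using that[OF z(1)] B.is_cone_vertex by blast
qed

section \<open>Push-forward dilations of the Wasserstein space\<close>

locale dilated_polish = dilated_space UNIV dist z D
  for z :: "'a::polish_space" and D
begin

lemma measurable_D: "0 \<le> t \<Longrightarrow> D t \<in> borel \<rightarrow>\<^sub>M borel"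
proof (intro borel_measurable_continuous_onI lipschitz_on_continuous_on lipschitz_onI)
  assume "0 \<le> t"
  then show "dist (D t x) (D t y) \<le> t * dist x y" for x y by (simp add: dist_D_same)
qed

abbreviation push :: "real \<Rightarrow> 'a measure \<Rightarrow> 'a measure" where
  "push t \<mu> \<equiv> distr \<mu> borel (D t)"

lemma push_P2:
  assumes \<mu>: "\<mu> \<in> P2" and t: "0 \<le> t"
  shows "push t \<mu> \<in> P2"
proof (rule P2I[of _ z])
  note [measurable_cong] = P2D(1)[OF \<mu>]
  note [measurable] = measurable_D[OF t]
  interpret prob_space \<mu> by (rule P2D \<mu>)+
  show "prob_space (push t \<mu>)" by (rule prob_space_distr) measurable
  show "integrable (push t \<mu>) (\<lambda>x. (dist z x)\<^sup>2)"
    using t P2D(4)[OF \<mu>, of z]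
    by (subst integrable_distr_eq) (simp_all add: dist_vertex_D power_mult_distrib)
qed simp

lemma W2_vertex_push:
  assumes \<mu>: "\<mu> \<in> P2" and t: "0 \<le> t"
  shows "W2 (return borel z) (push t \<mu>) = t * W2 (return borel z) \<mu>"
proof -
  note [measurable_cong] = P2D(1)[OF \<mu>]
  note [measurable] = measurable_D[OF t]
  have "(W2 (return borel z) (push t \<mu>))\<^sup>2 = (\<integral>x. (dist z (D t x))\<^sup>2 \<partial>\<mu>)"
    unfolding W2_return_sq[OF push_P2[OF assms]] by (subst integral_distr) auto
  also have "\<dots> = (t * W2 (return borel z) \<mu>)\<^sup>2"
    using t by (simp add: dist_vertex_D power_mult_distrib W2_return_sq[OF \<mu>])
  finally show ?thesis
    using t by (simp add: power2_eq_iff_nonneg W2_nonneg)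
qed

lemma push_push:
  assumes "\<mu> \<in> P2" "0 \<le> l" "0 \<le> k"
  shows "push l (push k \<mu>) = push (l * k) \<mu>"
proof -
  note [measurable_cong] = P2D(1)[OF assms(1)]
  note [measurable] = measurable_D[OF assms(2)] measurable_D[OF assms(3)]
  show ?thesis using assms by (simp add: distr_distr comp_def D_D)
qed

lemma push_1: "\<mu> \<in> P2 \<Longrightarrow> push 1 \<mu> = \<mu>"
  using distr_id2[of borel \<mu>] P2D(1)[of \<mu>] by (simp cong: distr_cong)

text \<open>An almost optimal coupling is pushed forward and the dilation formula integrated: the
  radial terms depend only on the marginals, and \<open>cost \<pi>\<close> has the positive
  coefficient \<open>l * k\<close>.\<close>

lemma W2_push_le:
  assumes P2: "\<mu> \<in> P2" "\<nu> \<in> P2" and pos: "0 < l" "0 < k"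
  shows "(W2 (push l \<mu>) (push k \<nu>))\<^sup>2 \<le> l * (l - k) * (W2 (return borel z) \<mu>)\<^sup>2 +
      k * (k - l) * (W2 (return borel z) \<nu>)\<^sup>2 + l * k * (W2 \<mu> \<nu>)\<^sup>2"
    (is "?W \<le> ?c + l * k * _")
proof (rule ccontr)
  assume "\<not> ?thesis"
  then have "(W2 \<mu> \<nu>)\<^sup>2 < (?W - ?c) / (l * k)"
    using pos by (simp add: field_simps)
  then have A: "W2 \<mu> \<nu> < sqrt ((?W - ?c) / (l * k))"
    by (rule real_less_rsqrt)
  \<comment> \<open>\<open>sqrt\<close> is negative on negative reals, so lying above
    \<open>W2 \<mu> \<nu>\<close> forces a nonnegative argument, and squaring then undoes
    \<open>sqrt\<close>.\<close>
  then have nn: "0 \<le> (?W - ?c) / (l * k)"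
    using W2_nonneg[of \<mu> \<nu>] by (smt (verit) real_sqrt_le_0_iff)
  obtain \<pi> where \<pi>: "\<pi> \<in> couplings \<mu> \<nu>" and c: "cost \<pi> < (sqrt ((?W - ?c) / (l * k)))\<^sup>2"
    using W2_less_couplingE[OF P2 A] by blast
  have D[measurable]: "D l \<in> borel \<rightarrow>\<^sub>M borel" "D k \<in> borel \<rightarrow>\<^sub>M borel"
    using pos by (simp_all add: measurable_D)
  have i: "integrable \<pi> (\<lambda>p. (dist z (fst p))\<^sup>2)" "integrable \<pi> (\<lambda>p. (dist z (snd p))\<^sup>2)"
    "(\<integral>p. (dist z (fst p))\<^sup>2 \<partial>\<pi>) = (W2 (return borel z) \<mu>)\<^sup>2"
    "(\<integral>p. (dist z (snd p))\<^sup>2 \<partial>\<pi>) = (W2 (return borel z) \<nu>)\<^sup>2"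
    using P2D(4)[OF P2(1), of z] P2D(4)[OF P2(2), of z]
    by (simp_all add: coupling_integral[OF \<pi>, where f = "\<lambda>y. (dist z y)\<^sup>2"] W2_return_sq P2)
  note j = integrable_cost[OF \<pi> P2]
  note push = distr_coupling[OF \<pi> D]
  have "?W \<le> (\<integral>p. (dist (D l (fst p)) (D k (snd p)))\<^sup>2 \<partial>\<pi>)"
    using W2_sq_le_cost[OF push(1)] push_P2 P2 pos unfolding push(2) by simp
  also have "\<dots> = (\<integral>p. l * (l - k) * (dist z (fst p))\<^sup>2 + k * (k - l) * (dist z (snd p))\<^sup>2 +
      l * k * (dist (fst p) (snd p))\<^sup>2 \<partial>\<pi>)"
    using pos by (simp add: D_dist_sq)
  also have "\<dots> = ?c + l * k * cost \<pi>"
    using i j by (simp add: cost_def)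
  also have "\<dots> < ?c + l * k * ((?W - ?c) / (l * k))"
    using c pos unfolding real_sqrt_pow2[OF nn]
    by (intro add_strict_left_mono mult_strict_left_mono) auto
  also have "\<dots> = ?W" using pos by simp
  finally show False by simp
qed

text \<open>The reverse of \<open>W2_push_le\<close> is the same bound for the inverse factors
  \<open>1 / l\<close> and \<open>1 / k\<close> at the pushed measures. A factor 0 collapses a
  measure to the vertex and is treated apart.\<close>

lemma W2_push:
  assumes P2: "\<mu> \<in> P2" "\<nu> \<in> P2" and nn: "0 \<le> l" "0 \<le> k"
  shows "(W2 (push l \<mu>) (push k \<nu>))\<^sup>2 = l * (l - k) * (W2 (return borel z) \<mu>)\<^sup>2 +
      k * (k - l) * (W2 (return borel z) \<nu>)\<^sup>2 + l * k * (W2 \<mu> \<nu>)\<^sup>2"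
proof -
  have push_0: "push 0 \<mu> = return borel z" if "\<mu> \<in> P2" for \<mu>
  proof -
    have "W2 (return borel z) (push 0 \<mu>) = 0" using W2_vertex_push[OF that, of 0] by simp
    then show ?thesis using W2_eq_0_iff[OF return_P2 push_P2[OF that]] by simp
  qed
  consider "l = 0" | "k = 0" | "0 < l" "0 < k" using nn by linarith
  then show ?thesis
  proof cases
    case 1
    then show ?thesis
      using W2_vertex_push[OF P2(2) nn(2)] P2 by (simp add: push_0 power_mult_distrib power2_eq_square)
  next
    case 2
    then show ?thesis
      using W2_vertex_push[OF P2(1) nn(1)] P2
      by (simp add: push_0 W2_commute[of _ "return borel z"] power_mult_distrib power2_eq_square)
  next
    case 3
    define a b where "a = (W2 (return borel z) \<mu>)\<^sup>2" and "b = (W2 (return borel z) \<nu>)\<^sup>2"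
    let ?W = "(W2 (push l \<mu>) (push k \<nu>))\<^sup>2"
    have "(W2 \<mu> \<nu>)\<^sup>2 = (W2 (push (1 / l) (push l \<mu>)) (push (1 / k) (push k \<nu>)))\<^sup>2"
      using 3 P2 by (simp add: push_push push_1)
    also have "\<dots> \<le> 1 / l * (1 / l - 1 / k) * (l\<^sup>2 * a) + 1 / k * (1 / k - 1 / l) * (k\<^sup>2 * b) + 1 / l * (1 / k) * ?W"
      using W2_push_le[OF push_P2[OF P2(1) nn(1)] push_P2[OF P2(2) nn(2)], of "1 / l" "1 / k"] 3
      by (simp only: W2_vertex_push[OF P2(1) nn(1)] W2_vertex_push[OF P2(2) nn(2)]
          power_mult_distrib a_def b_def divide_pos_pos zero_less_one)
    finally have "l * k * (W2 \<mu> \<nu>)\<^sup>2 \<le> l * k * (1 / l * (1 / l - 1 / k) * (l\<^sup>2 * a) +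
        1 / k * (1 / k - 1 / l) * (k\<^sup>2 * b) + 1 / l * (1 / k) * ?W)"
      using 3 by (intro mult_left_mono) auto
    also have "\<dots> = l * (k - l) * a + k * (l - k) * b + ?W"
      using 3 by (simp add: field_simps power2_eq_square)
    finally show ?thesis
      using W2_push_le[OF P2 3] by (simp add: a_def b_def algebra_simps)
  qed
qed

lemma dilated_space_P2: "dilated_space P2 W2 (return borel z) push"
proof -
  interpret W: Metric_space "P2 :: 'a measure set" W2 by (rule Metric_space_W2)
  show ?thesis
    by unfold_locales (auto simp: return_P2 cone_dilation_def push_P2 push_1 W2_push)
qed

lemma is_cone_vertex_P2:
  assumes "w \<noteq> z"
  shows "is_cone_vertex P2 W2 (return borel z)"
  using dilated_space.is_cone_vertex[OF dilated_space_P2, of "return borel w"] assms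
  by (simp add: return_P2 return_eq_iff)

end

lemma is_cone_vertex_P2I:
  assumes "is_cone_vertex (UNIV :: 'a::polish_space set) dist z"
  shows "is_cone_vertex P2 W2 (return borel z)"
proof -
  obtain D w where "dilated_space UNIV dist z D" and w: "w \<noteq> z"
    using is_cone_vertexE[OF Met_TC.Metric_space_axioms assms] by blast
  then interpret dilated_space UNIV dist z D by simp
  interpret dilated_polish z D ..
  show ?thesis using is_cone_vertex_P2[OF w] .
qed

theorem theorem1p1:
  shows "(has_cone_structure (P2 :: 'a::polish_space measure set) W2 \<longleftrightarrow>
            has_cone_structure (UNIV :: 'a set) dist) \<and>
         (has_cone_structure (UNIV :: 'a set) dist \<longrightarrow>
            (\<forall>\<mu> x. is_cone_vertex (P2 :: 'a measure set) W2 \<mu> \<and>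
                   is_cone_vertex (UNIV :: 'a set) dist x \<longrightarrow>
               (non_branching_at (P2 :: 'a measure set) W2 \<mu> \<longleftrightarrow>
                non_branching_at (UNIV :: 'a set) dist x)))"
proof (intro conjI impI allI)
  have "(P2 :: 'a measure set) \<noteq> {}" using return_P2 by blast
  then show "has_cone_structure (P2 :: 'a measure set) W2 \<longleftrightarrow> has_cone_structure (UNIV :: 'a set) dist"
    by (auto simp: has_cone_structure_iff elim: is_cone_vertex_P2E intro: is_cone_vertex_P2I)
next
  fix \<mu> :: "'a measure" and x :: 'a
  assume v: "is_cone_vertex P2 W2 \<mu> \<and> is_cone_vertex UNIV dist x"
  \<comment> \<open>The vertex \<open>z\<close> may differ from \<open>x\<close>: branching at
    \<open>\<mu>\<close> is branching at \<open>z\<close>, and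
    \<open>non_branching_at_vertices\<close> passes between \<open>z\<close> and
    \<open>x\<close>.\<close>
  then obtain z where z: "\<mu> = return borel z" "is_cone_vertex UNIV dist z"
    using is_cone_vertex_P2E by blast
  obtain D D' where D: "dilated_space UNIV dist z D" "dilated_space UNIV dist x D'"
    using is_cone_vertexE[OF Met_TC.Metric_space_axioms] v z(2) by metis
  show "non_branching_at P2 W2 \<mu> \<longleftrightarrow> non_branching_at UNIV dist x"
    unfolding z non_branching_P2_return_iff
    using non_branching_at_vertices[OF D] non_branching_at_vertices[OF D(2,1)] by blast
qed

end
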